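(* Let $\mathcal{C}$ be a small category satisfying the dual of the amalgamation property and such that the atomic topology $J_{at}$ on $\mathcal{C}$ is subcanonical. Then every atom of $\mathbf{Sh}(\mathcal{C},J_{at})$ is, up to isomorphism, of the form $l(c)$ for some $c\in\mathcal{C}$ if and only if for every object $c$ of $\mathcal{C}$ and every equivalence relation $R$ on $\mathcal{C}(-,c)$ in $[\mathcal{C}^{\mathrm{op}},\mathbf{Set}]$ there exists an arrow $f:c\to d$ in $\mathcal{C}$ such that for any arrows $a,b:e\to c$ in $\mathcal{C}$, $f\circ a=f\circ b$ if and only if there exists an arrow $h$ (with codomain $e$) such that $(a\circ h,b\circ h)\in R$.
   Context: The dual of the amalgamation property says that any two arrows of $\mathcal{C}$ with common codomain can be completed to a commutative square. The atomic topology $J_{at}$ on $\mathcal{C}$ has as covering sieves exactly the non-empty ones. $l:\mathcal{C}\to\mathbf{Sh}(\mathcal{C},J_{at})$ is the composite of the Yoneda embedding $\mathcal{C}\to[\mathcal{C}^{\mathrm{op}},\mathbf{Set}]$ with the associated sheaf functor. An atom of a topos is a non-zero object with no proper non-zero subobjects. An equivalence relation $R$ on $\mathcal{C}(-,c)$ in $[\mathcal{C}^{\mathrm{op}},\mathbf{Set}]$ is a subfunctor of $\mathcal{C}(-,c)\times\mathcal{C}(-,c)$ which at each object $e$ is an equivalence relation on $\mathcal{C}(e,c)$; $(a,b)\in R$ means that the pair lies in the value of $R$ at the common domain of $a$ and $b$. *)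

theory Defs
  imports "HOL-Library.FuncSet"
begin

section \<open>Categories\<close>

record ('o, 'a) cat =
  Obj :: "'o set"
  Arr :: "'a set"
  Dom :: "'a \<Rightarrow> 'o"
  Cod :: "'a \<Rightarrow> 'o"
  Ident :: "'o \<Rightarrow> 'a"
  Comp :: "'a \<Rightarrow> 'a \<Rightarrow> 'a"  (infixr "\<odot>\<index>" 70)

definition hom :: "('o, 'a, 'm) cat_scheme \<Rightarrow> 'o \<Rightarrow> 'o \<Rightarrow> 'a set" where
  "hom C c d = {f \<in> Arr C. Dom C f = c \<and> Cod C f = d}"

text \<open>The composite \<open>g \<odot>\<^bsub>C\<^esub> f\<close> is in applicative order: first \<open>f\<close>, then \<open>g\<close>.\<close>

locale category =
  fixes C (structure)
  assumes Dom_Obj: "f \<in> Arr C \<Longrightarrow> Dom C f \<in> Obj C"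
    and Cod_Obj: "f \<in> Arr C \<Longrightarrow> Cod C f \<in> Obj C"
    and Ident_hom: "c \<in> Obj C \<Longrightarrow> Ident C c \<in> hom C c c"
    and Comp_hom: "f \<in> hom C c d \<Longrightarrow> g \<in> hom C d e \<Longrightarrow> g \<odot> f \<in> hom C c e"
    and Ident_left: "f \<in> hom C c d \<Longrightarrow> Ident C d \<odot> f = f"
    and Ident_right: "f \<in> hom C c d \<Longrightarrow> f \<odot> Ident C c = f"
    and Comp_assoc: "f \<in> hom C b c \<Longrightarrow> g \<in> hom C c d \<Longrightarrow> h \<in> hom C d e
      \<Longrightarrow> (h \<odot> g) \<odot> f = h \<odot> (g \<odot> f)"

definition monic :: "('o, 'a, 'm) cat_scheme \<Rightarrow> 'a \<Rightarrow> bool" where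
  "monic C m \<longleftrightarrow> m \<in> Arr C \<and>
    (\<forall>x\<in>Obj C. \<forall>f\<in>hom C x (Dom C m). \<forall>g\<in>hom C x (Dom C m).
      m \<odot>\<^bsub>C\<^esub> f = m \<odot>\<^bsub>C\<^esub> g \<longrightarrow> f = g)"

definition isomorphism :: "('o, 'a, 'm) cat_scheme \<Rightarrow> 'a \<Rightarrow> bool" where
  "isomorphism C f \<longleftrightarrow> f \<in> Arr C \<and>
    (\<exists>g\<in>hom C (Cod C f) (Dom C f).
      g \<odot>\<^bsub>C\<^esub> f = Ident C (Dom C f) \<and> f \<odot>\<^bsub>C\<^esub> g = Ident C (Cod C f))"

definition isomorphic :: "('o, 'a, 'm) cat_scheme \<Rightarrow> 'o \<Rightarrow> 'o \<Rightarrow> bool" where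
  "isomorphic C x y \<longleftrightarrow> (\<exists>f\<in>hom C x y. isomorphism C f)"

definition initial_object :: "('o, 'a, 'm) cat_scheme \<Rightarrow> 'o \<Rightarrow> bool" where
  "initial_object C z \<longleftrightarrow> z \<in> Obj C \<and> (\<forall>x\<in>Obj C. \<exists>!f. f \<in> hom C z x)"

text \<open>Subobjects are represented by monomorphisms; a subobject is non-proper
  iff the monomorphism is invertible, and zero iff its domain is initial.\<close>

definition atom :: "('o, 'a, 'm) cat_scheme \<Rightarrow> 'o \<Rightarrow> bool" where
  "atom C x \<longleftrightarrow> x \<in> Obj C \<and> \<not> initial_object C x \<and>
    (\<forall>m. monic C m \<and> Cod C m = x \<longrightarrow> initial_object C (Dom C m) \<or> isomorphism C m)"

definition dual_amalgamation :: "('o, 'a, 'm) cat_scheme \<Rightarrow> bool" where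
  "dual_amalgamation C \<longleftrightarrow>
    (\<forall>f\<in>Arr C. \<forall>g\<in>Arr C. Cod C f = Cod C g \<longrightarrow>
      (\<exists>x\<in>Obj C. \<exists>h\<in>hom C x (Dom C f). \<exists>k\<in>hom C x (Dom C g). f \<odot>\<^bsub>C\<^esub> h = g \<odot>\<^bsub>C\<^esub> k))"

section \<open>Presheaves\<close>

text \<open>\<open>('o, 'a, 'x) presheaf\<close> is the type of contravariant functors to sets of elements of
  type \<open>'x\<close>.  Natural transformations may relate presheaves with different element types,
  so that representables (elements: arrows) can be mapped to presheaves over any other type
  of elements.\<close>

record ('o, 'a, 'x) presheaf =
  Sec :: "'o \<Rightarrow> 'x set"
  Res :: "'a \<Rightarrow> 'x \<Rightarrow> 'x"

definition is_presheaf :: "('o, 'a) cat \<Rightarrow> ('o, 'a, 'x) presheaf \<Rightarrow> bool" where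
  "is_presheaf C P \<longleftrightarrow>
    (\<forall>a\<in>Arr C. \<forall>x\<in>Sec P (Cod C a). Res P a x \<in> Sec P (Dom C a)) \<and>
    (\<forall>c\<in>Obj C. \<forall>x\<in>Sec P c. Res P (Ident C c) x = x) \<and>
    (\<forall>a\<in>Arr C. \<forall>b\<in>Arr C. Cod C b = Dom C a \<longrightarrow>
      (\<forall>x\<in>Sec P (Cod C a). Res P (a \<odot>\<^bsub>C\<^esub> b) x = Res P b (Res P a x)))"

text \<open>Components are extensional functions, so that equality of natural transformations is
  equality in the logic.\<close>

definition nat_trans ::
  "('o, 'a) cat \<Rightarrow> ('o, 'a, 'x) presheaf \<Rightarrow> ('o, 'a, 'y) presheaf \<Rightarrow> ('o \<Rightarrow> 'x \<Rightarrow> 'y) set" where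
  "nat_trans C P Q = {\<tau> \<in> (\<Pi>\<^sub>E c\<in>Obj C. Sec P c \<rightarrow>\<^sub>E Sec Q c).
    \<forall>a\<in>Arr C. \<forall>x\<in>Sec P (Cod C a). \<tau> (Dom C a) (Res P a x) = Res Q a (\<tau> (Cod C a) x)}"

definition nt_id :: "('o, 'a) cat \<Rightarrow> ('o, 'a, 'x) presheaf \<Rightarrow> 'o \<Rightarrow> 'x \<Rightarrow> 'x" where
  "nt_id C P = (\<lambda>c\<in>Obj C. \<lambda>x\<in>Sec P c. x)"

text \<open>\<open>nt_comp C P \<sigma> \<tau>\<close> is \<open>\<sigma>\<close> after \<open>\<tau>\<close>, where \<open>P\<close> is the domain of \<open>\<tau>\<close>.\<close>

definition nt_comp ::
  "('o, 'a) cat \<Rightarrow> ('o, 'a, 'x) presheaf \<Rightarrow> ('o \<Rightarrow> 'y \<Rightarrow> 'z) \<Rightarrow> ('o \<Rightarrow> 'x \<Rightarrow> 'y) \<Rightarrow> 'o \<Rightarrow> 'x \<Rightarrow> 'z" where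
  "nt_comp C P \<sigma> \<tau> = (\<lambda>c\<in>Obj C. compose (Sec P c) (\<sigma> c) (\<tau> c))"

definition yoneda :: "('o, 'a) cat \<Rightarrow> 'o \<Rightarrow> ('o, 'a, 'a) presheaf" where
  "yoneda C c = \<lparr>Sec = (\<lambda>e. hom C e c), Res = (\<lambda>a g. g \<odot>\<^bsub>C\<^esub> a)\<rparr>"

definition presheaf_prod ::
  "('o, 'a, 'x) presheaf \<Rightarrow> ('o, 'a, 'y) presheaf \<Rightarrow> ('o, 'a, 'x \<times> 'y) presheaf" where
  "presheaf_prod P Q =
    \<lparr>Sec = (\<lambda>c. Sec P c \<times> Sec Q c), Res = (\<lambda>a (x, y). (Res P a x, Res Q a y))\<rparr>"

definition subfunctor :: "('o, 'a) cat \<Rightarrow> ('o \<Rightarrow> 'x set) \<Rightarrow> ('o, 'a, 'x) presheaf \<Rightarrow> bool" where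
  "subfunctor C S P \<longleftrightarrow>
    (\<forall>c\<in>Obj C. S c \<subseteq> Sec P c) \<and> (\<forall>a\<in>Arr C. \<forall>x\<in>S (Cod C a). Res P a x \<in> S (Dom C a))"

definition presheaf_equiv_rel ::
  "('o, 'a) cat \<Rightarrow> ('o, 'a, 'x) presheaf \<Rightarrow> ('o \<Rightarrow> ('x \<times> 'x) set) \<Rightarrow> bool" where
  "presheaf_equiv_rel C P R \<longleftrightarrow>
    subfunctor C R (presheaf_prod P P) \<and> (\<forall>e\<in>Obj C. equiv (Sec P e) (R e))"

section \<open>Sheaves\<close>

definition sieve :: "('o, 'a) cat \<Rightarrow> 'o \<Rightarrow> 'a set \<Rightarrow> bool" where
  "sieve C c S \<longleftrightarrow> S \<subseteq> {f \<in> Arr C. Cod C f = c} \<and>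
    (\<forall>f\<in>S. \<forall>g\<in>Arr C. Cod C g = Dom C f \<longrightarrow> f \<odot>\<^bsub>C\<^esub> g \<in> S)"

definition atomic_topology :: "('o, 'a) cat \<Rightarrow> 'o \<Rightarrow> 'a set set" where
  "atomic_topology C c = {S. sieve C c S \<and> S \<noteq> {}}"

definition matching_family ::
  "('o, 'a) cat \<Rightarrow> ('o, 'a, 'x) presheaf \<Rightarrow> 'a set \<Rightarrow> ('a \<Rightarrow> 'x) \<Rightarrow> bool" where
  "matching_family C P S s \<longleftrightarrow>
    (\<forall>f\<in>S. s f \<in> Sec P (Dom C f)) \<and>
    (\<forall>f\<in>S. \<forall>g\<in>Arr C. Cod C g = Dom C f \<longrightarrow> s (f \<odot>\<^bsub>C\<^esub> g) = Res P g (s f))"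

definition is_sheaf ::
  "('o, 'a) cat \<Rightarrow> ('o \<Rightarrow> 'a set set) \<Rightarrow> ('o, 'a, 'x) presheaf \<Rightarrow> bool" where
  "is_sheaf C J P \<longleftrightarrow> is_presheaf C P \<and>
    (\<forall>c\<in>Obj C. \<forall>S\<in>J c. \<forall>s. matching_family C P S s \<longrightarrow>
      (\<exists>!x. x \<in> Sec P c \<and> (\<forall>f\<in>S. Res P f x = s f)))"

definition subcanonical :: "('o, 'a) cat \<Rightarrow> ('o \<Rightarrow> 'a set set) \<Rightarrow> bool" where
  "subcanonical C J \<longleftrightarrow> (\<forall>c\<in>Obj C. is_sheaf C J (yoneda C c))"

type_synonym ('o, 'a, 'x) presheaf_arrow =
  "('o, 'a, 'x) presheaf \<times> ('o \<Rightarrow> 'x \<Rightarrow> 'x) \<times> ('o, 'a, 'x) presheaf"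

definition Sh ::
  "('o, 'a) cat \<Rightarrow> ('o \<Rightarrow> 'a set set) \<Rightarrow> (('o, 'a, 'x) presheaf, ('o, 'a, 'x) presheaf_arrow) cat" where
  "Sh C J =
    \<lparr>Obj = {F. is_sheaf C J F},
     Arr = {(F, \<tau>, G). is_sheaf C J F \<and> is_sheaf C J G \<and> \<tau> \<in> nat_trans C F G},
     Dom = (\<lambda>(F, \<tau>, G). F),
     Cod = (\<lambda>(F, \<tau>, G). G),
     Ident = (\<lambda>F. (F, nt_id C F, F)),
     Comp = (\<lambda>(G', \<sigma>, H) (F, \<tau>, G). (F, nt_comp C F \<sigma> \<tau>, H))\<rparr>"

text \<open>The associated sheaf functor is the left adjoint of the inclusion of sheaves into
  presheaves: its value at \<open>P\<close> is a sheaf \<open>L\<close> with a universal arrow \<open>\<eta>\<close> from \<open>P\<close>.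
  The type \<open>'y\<close> of elements of sheaves plays the role of the universe of sets; it is determined
  by the context in which \<open>associated_sheaf\<close> and \<open>l_obj\<close> are used.\<close>

definition sheafification ::
  "('o, 'a) cat \<Rightarrow> ('o \<Rightarrow> 'a set set) \<Rightarrow> ('o, 'a, 'x) presheaf \<Rightarrow>
    ('o, 'a, 'y) presheaf \<Rightarrow> ('o \<Rightarrow> 'x \<Rightarrow> 'y) \<Rightarrow> bool" where
  "sheafification C J P L \<eta> \<longleftrightarrow> is_sheaf C J L \<and> \<eta> \<in> nat_trans C P L \<and>
    (\<forall>G :: ('o, 'a, 'y) presheaf. is_sheaf C J G \<longrightarrow>
      (\<forall>\<phi>\<in>nat_trans C P G. \<exists>!\<psi>. \<psi> \<in> nat_trans C L G \<and> nt_comp C P \<psi> \<eta> = \<phi>))"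

definition associated_sheaf ::
  "('o, 'a) cat \<Rightarrow> ('o \<Rightarrow> 'a set set) \<Rightarrow> ('o, 'a, 'x) presheaf \<Rightarrow> ('o, 'a, 'y) presheaf" where
  "associated_sheaf C J P = (SOME L. \<exists>\<eta>. sheafification C J P L \<eta>)"

definition l_obj :: "('o, 'a) cat \<Rightarrow> ('o \<Rightarrow> 'a set set) \<Rightarrow> 'o \<Rightarrow> ('o, 'a, 'y) presheaf" where
  "l_obj C J c = associated_sheaf C J (yoneda C c)"

text \<open>HOL has no type of all sets, so \<open>Set\<close> is rendered as the sets of elements of a type
  \<open>'u\<close>, and smallness of \<open>C\<close> (with arrows of type \<open>'a\<close>) as an injection of \<open>'a \<times> 'a\<close> into \<open>'u\<close>.
  This loses no atoms: a section over \<open>e\<close> of an atom of \<open>Sh C (atomic_topology C)\<close> is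
  determined by a pair of arrows \<open>(h, g)\<close>, namely some \<open>h\<close> into \<open>e\<close> along which it restricts to
  the image of \<open>g : Dom C h \<rightarrow> c\<close> under a fixed locally surjective map from \<open>yoneda C c\<close>.\<close>

lemma sheafification_of_sheaf:
  fixes P :: "('o, 'a, 'x) presheaf" and i :: "'x \<Rightarrow> 'y"
  assumes C: "category C" and P: "is_sheaf C J P" and i: "inj i"
  defines "L \<equiv> \<lparr>Sec = (\<lambda>c. i ` Sec P c), Res = (\<lambda>a y. i (Res P a (inv i y)))\<rparr>"
  shows "sheafification C J P L (\<lambda>c\<in>Obj C. \<lambda>x\<in>Sec P c. i x)"
proof -
  interpret category C by fact
  have [simp]: "inv i (i x) = x" for x using i by simp
  have [simp]: "i x = i y \<longleftrightarrow> x = y" for x y using i by (simp add: inj_eq)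
  have SL: "Sec L c = i ` Sec P c" "Res L a (i x) = i (Res P a x)" for c a x by (simp_all add: L_def)
  have pP: "is_presheaf C P" using P by (simp add: is_sheaf_def)
  have pL: "is_presheaf C L"
    using pP unfolding is_presheaf_def by (auto simp: SL)
  have "\<exists>!y. y \<in> Sec L c \<and> (\<forall>f\<in>S. Res L f y = s f)"
    if "c \<in> Obj C" "S \<in> J c" and m: "matching_family C L S s" for c S s
  proof -
    have s: "s f = i (inv i (s f))" "inv i (s f) \<in> Sec P (Dom C f)" if "f \<in> S" for f
      using m that by (auto simp: matching_family_def SL)
    have rs: "inv i (s (f \<odot>\<^bsub>C\<^esub> g)) = Res P g (inv i (s f))" if "f \<in> S" "g \<in> Arr C" "Cod C g = Dom C f" for f g
      using m that s(1)[OF that(1)] SL(2)[of g "inv i (s f)"] by (metis (no_types, lifting) matching_family_def \<open>\<And>x. inv i (i x) = x\<close>)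
    have "matching_family C P S (\<lambda>f. inv i (s f))"
      using s rs by (auto simp: matching_family_def)
    then have "\<exists>!x. x \<in> Sec P c \<and> (\<forall>f\<in>S. Res P f x = inv i (s f))"
      using P that by (simp add: is_sheaf_def)
    then obtain x where x: "x \<in> Sec P c" "\<forall>f\<in>S. Res P f x = inv i (s f)"
      and u: "\<And>x'. x' \<in> Sec P c \<Longrightarrow> \<forall>f\<in>S. Res P f x' = inv i (s f) \<Longrightarrow> x' = x" by blast
    show ?thesis
    proof (rule ex1I[of _ "i x"])
      show "i x \<in> Sec L c \<and> (\<forall>f\<in>S. Res L f (i x) = s f)" using x s(1) by (auto simp: SL)
    next
      fix y assume y: "y \<in> Sec L c \<and> (\<forall>f\<in>S. Res L f y = s f)"
      then obtain x' where x': "y = i x'" "x' \<in> Sec P c" by (auto simp: SL)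
      have "Res P f x' = inv i (s f)" if "f \<in> S" for f using y that x' SL(2)[of f x'] by (metis \<open>\<And>x. inv i (i x) = x\<close>)
      then show "y = i x" using u x' by blast
    qed
  qed
  then have L: "is_sheaf C J L" using pL by (simp add: is_sheaf_def)
  define \<eta> where "\<eta> = (\<lambda>c\<in>Obj C. \<lambda>x\<in>Sec P c. i x)"
  have e: "\<eta> c x = i x" if "c \<in> Obj C" "x \<in> Sec P c" for c x using that by (simp add: \<eta>_def)
  have rP: "Res P a x \<in> Sec P (Dom C a)" if "a \<in> Arr C" "x \<in> Sec P (Cod C a)" for a x
    using pP that by (simp add: is_presheaf_def)
  have \<eta>: "\<eta> \<in> nat_trans C P L"
    unfolding nat_trans_def
  proof (intro CollectI conjI ballI)
    show "\<eta> \<in> (\<Pi>\<^sub>E c\<in>Obj C. Sec P c \<rightarrow>\<^sub>E Sec L c)" by (auto simp: \<eta>_def SL)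
  qed (simp add: e Dom_Obj Cod_Obj rP SL)
  have "\<exists>!\<psi>. \<psi> \<in> nat_trans C L G \<and> nt_comp C P \<psi> \<eta> = \<phi>"
    if G: "is_sheaf C J G" and \<phi>: "\<phi> \<in> nat_trans C P G" for G :: "('o, 'a, 'y) presheaf" and \<phi>
  proof -
    have ph: "\<phi> \<in> (\<Pi>\<^sub>E c\<in>Obj C. Sec P c \<rightarrow>\<^sub>E Sec G c)" 
      and phn: "\<And>a x. a \<in> Arr C \<Longrightarrow> x \<in> Sec P (Cod C a) \<Longrightarrow> \<phi> (Dom C a) (Res P a x) = Res G a (\<phi> (Cod C a) x)"
      using \<phi> by (auto simp: nat_trans_def)
    have ph1: "\<phi> c x \<in> Sec G c" if "c \<in> Obj C" "x \<in> Sec P c" for c x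
      using PiE_mem[OF PiE_mem[OF ph that(1)] that(2)] .
    define \<psi> where "\<psi> = (\<lambda>c\<in>Obj C. \<lambda>y\<in>Sec L c. \<phi> c (inv i y))"
    have p: "\<psi> c (i x) = \<phi> c x" if "c \<in> Obj C" "x \<in> Sec P c" for c x using that by (simp add: \<psi>_def SL)
    have 1: "\<psi> \<in> nat_trans C L G"
      unfolding nat_trans_def
    proof (intro CollectI conjI ballI)
      show "\<psi> \<in> (\<Pi>\<^sub>E c\<in>Obj C. Sec L c \<rightarrow>\<^sub>E Sec G c)" by (auto simp: \<psi>_def SL ph1)
    next
      fix a y assume "a \<in> Arr C" "y \<in> Sec L (Cod C a)"
      then show "\<psi> (Dom C a) (Res L a y) = Res G a (\<psi> (Cod C a) y)"
        by (auto simp: SL p Dom_Obj Cod_Obj rP phn)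
    qed
    have 2: "nt_comp C P \<psi> \<eta> = \<phi>"
    proof
      fix c show "nt_comp C P \<psi> \<eta> c = \<phi> c"
      proof (cases "c \<in> Obj C")
        case True
        have "\<phi> c \<in> Sec P c \<rightarrow>\<^sub>E Sec G c" using ph True by (rule PiE_mem)
        then have "\<phi> c x = undefined" if "x \<notin> Sec P c" for x using that by (rule PiE_arb)
        then show ?thesis using True by (auto simp: nt_comp_def compose_def e p restrict_def fun_eq_iff)
      next
        case False then show ?thesis using PiE_arb[OF ph] by (simp add: nt_comp_def)
      qed
    qed
    show ?thesis
    proof (rule ex1I[of _ \<psi>])
      show "\<psi> \<in> nat_trans C L G \<and> nt_comp C P \<psi> \<eta> = \<phi>" using 1 2 by simp
    next
      fix \<psi>' assume a: "\<psi>' \<in> nat_trans C L G \<and> nt_comp C P \<psi>' \<eta> = \<phi>"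
      then have t: "\<psi>' \<in> (\<Pi>\<^sub>E c\<in>Obj C. Sec L c \<rightarrow>\<^sub>E Sec G c)" by (simp add: nat_trans_def)
      have v: "\<psi>' c (i x) = \<phi> c x" if "c \<in> Obj C" "x \<in> Sec P c" for c x
      proof -
        have "nt_comp C P \<psi>' \<eta> c x = \<psi>' c (i x)" using that by (simp add: nt_comp_def compose_def e)
        then show ?thesis using a by simp
      qed
      show "\<psi>' = \<psi>"
      proof
        fix c show "\<psi>' c = \<psi> c"
        proof (cases "c \<in> Obj C")
          case True
          have "\<psi>' c \<in> Sec L c \<rightarrow>\<^sub>E Sec G c" using t True by (rule PiE_mem)
          then have "\<psi>' c x = undefined" if "x \<notin> Sec L c" for x using that by (rule PiE_arb)
          then show ?thesis using True v by (auto simp: \<psi>_def fun_eq_iff restrict_def SL)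
        next
          case False then show ?thesis using PiE_arb[OF t] by (simp add: \<psi>_def)
        qed
      qed
    qed
  qed
  then show ?thesis using L \<eta> unfolding sheafification_def \<eta>_def by blast
qed

text \<open>The choice in \<open>l_obj\<close> therefore succeeds as soon as the topology is subcanonical and the
  arrows of \<open>C\<close> embed into the type of elements of sheaves.\<close>

lemma l_obj_sheafification:
  assumes "category C" "subcanonical C J" "c \<in> Obj C" "inj (i :: 'a \<Rightarrow> 'y)"
  shows "\<exists>\<eta>. sheafification C J (yoneda C c) (l_obj C J c :: ('o, 'a, 'y) presheaf) \<eta>"
proof -
  have "\<exists>L :: ('o, 'a, 'y) presheaf. \<exists>\<eta>. sheafification C J (yoneda C c) L \<eta>"
    using sheafification_of_sheaf[OF assms(1) _ assms(4), of J "yoneda C c"] assms(2,3)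
    unfolding subcanonical_def by blast
  then show ?thesis unfolding l_obj_def associated_sheaf_def by (rule someI_ex)
qed

lemma category_Sh:
  assumes "category C" 
  shows "category (Sh C J :: (('o, 'a, 'x) presheaf, _) cat)"
proof -
  interpret category C by fact
  have cl: "nt_comp C P \<sigma> \<tau> \<in> nat_trans C P R" if s: "\<tau> \<in> nat_trans C P Q" "\<sigma> \<in> nat_trans C Q R"
      and P: "is_presheaf C P"  for P Q R :: "('o, 'a, 'x) presheaf" and \<sigma> \<tau>
  proof -
    have 1: "\<tau> c x \<in> Sec Q c" if "c \<in> Obj C" "x \<in> Sec P c" for c x
      using s that by (auto simp: nat_trans_def dest!: PiE_mem)
    have 2: "\<sigma> c x \<in> Sec R c" if "c \<in> Obj C" "x \<in> Sec Q c" for c x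
      using s that by (auto simp: nat_trans_def dest!: PiE_mem)
    show ?thesis unfolding nat_trans_def
    proof (intro CollectI conjI ballI)
      show "nt_comp C P \<sigma> \<tau> \<in> (\<Pi>\<^sub>E c\<in>Obj C. Sec P c \<rightarrow>\<^sub>E Sec R c)" 
        by (auto simp: nt_comp_def compose_def 1 2)
    next
      fix a x assume a: "a \<in> Arr C" "x \<in> Sec P (Cod C a)"
      have "Res P a x \<in> Sec P (Dom C a)" using a P by (simp add: is_presheaf_def)
      then show "nt_comp C P \<sigma> \<tau> (Dom C a) (Res P a x) = Res R a (nt_comp C P \<sigma> \<tau> (Cod C a) x)"
        using a s 1 by (auto simp: nt_comp_def compose_def Dom_Obj Cod_Obj nat_trans_def)
    qed
  qed
  have ext: "\<sigma> = \<tau>" if "\<sigma> \<in> nat_trans C P Q" "\<tau> \<in> nat_trans C P Q" 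
     "\<And>c x. c \<in> Obj C \<Longrightarrow> x \<in> Sec P c \<Longrightarrow> \<sigma> c x = \<tau> c x" for \<sigma> \<tau> and P Q :: "('o, 'a, 'x) presheaf"
  proof (rule PiE_ext[of _ "Obj C" "\<lambda>c. Sec P c \<rightarrow>\<^sub>E Sec Q c"])
    show s: "\<sigma> \<in> (\<Pi>\<^sub>E c\<in>Obj C. Sec P c \<rightarrow>\<^sub>E Sec Q c)" and t: "\<tau> \<in> (\<Pi>\<^sub>E c\<in>Obj C. Sec P c \<rightarrow>\<^sub>E Sec Q c)"
      using that by (simp_all add: nat_trans_def)
    fix c assume "c \<in> Obj C"
    then show "\<sigma> c = \<tau> c"
      by (intro PiE_ext[OF PiE_mem[OF s] PiE_mem[OF t]] that(3))
  qed
  have mem: "\<tau> c x \<in> Sec Q c" if "\<tau> \<in> nat_trans C P Q" "c \<in> Obj C" "x \<in> Sec P c" for c x \<tau> and P Q :: "('o, 'a, 'x) presheaf"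
      using that by (auto simp: nat_trans_def dest!: PiE_mem)
  have idn: "nt_id C P \<in> nat_trans C P P" if "is_presheaf C P" for P :: "('o, 'a, 'x) presheaf"
    using that by (auto simp: nat_trans_def nt_id_def is_presheaf_def Dom_Obj Cod_Obj)
  have sp: "is_presheaf C P" if "is_sheaf C J P" for P :: "('o, 'a, 'x) presheaf" using that by (simp add: is_sheaf_def)
  show ?thesis
  proof
    fix f and c d :: "('o, 'a, 'x) presheaf" assume "f \<in> hom (Sh C J) c d"
    then obtain \<tau> where t: "f = (c, \<tau>, d)" "\<tau> \<in> nat_trans C c d" "is_sheaf C J c" "is_sheaf C J d"
      by (auto simp: hom_def Sh_def)
    have pc: "is_presheaf C c" "is_presheaf C d" using t sp by auto
    have "nt_comp C c (nt_id C d) \<tau> = \<tau>"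
      by (rule ext[OF cl[OF t(2) idn[OF pc(2)] pc(1)] t(2)])
        (simp add: nt_comp_def compose_def nt_id_def mem[OF t(2)])
    moreover have "nt_comp C c \<tau> (nt_id C c) = \<tau>"
      by (rule ext[OF cl[OF idn[OF pc(1)] t(2) pc(1)] t(2)])
        (simp add: nt_comp_def compose_def nt_id_def)
    ultimately show "Ident (Sh C J) d \<odot>\<^bsub>Sh C J\<^esub> f = f" "f \<odot>\<^bsub>Sh C J\<^esub> Ident (Sh C J) c = f"
      using t(1) by (simp_all add: Sh_def)
  next
    fix f g and c d e :: "('o, 'a, 'x) presheaf" assume "f \<in> hom (Sh C J) c d" "g \<in> hom (Sh C J) d e"
    then show "g \<odot>\<^bsub>Sh C J\<^esub> f \<in> hom (Sh C J) c e" using cl sp by (auto simp: hom_def Sh_def)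
  next
    fix f g h and b c d e :: "('o, 'a, 'x) presheaf" assume "f \<in> hom (Sh C J) b c" "g \<in> hom (Sh C J) c d" "h \<in> hom (Sh C J) d e"
    then show "(h \<odot>\<^bsub>Sh C J\<^esub> g) \<odot>\<^bsub>Sh C J\<^esub> f = h \<odot>\<^bsub>Sh C J\<^esub> (g \<odot>\<^bsub>Sh C J\<^esub> f)" 
      by (auto simp: hom_def Sh_def nt_comp_def compose_def fun_eq_iff restrict_def mem)
  qed (auto simp: Sh_def hom_def idn sp)
qed

end

theory Submission
  imports Defs
begin

text \<open>
  For the atomic topology a sheaf is a presheaf with effective descent along every single arrow.
  The image of a monomorphism of sheaves is therefore closed under descent, and the atoms turn out
  to be the non-empty sheaves \<open>A\<close> with a locally surjective map from some \<open>yoneda C c\<close>, given by a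
  section \<open>x\<close> over \<open>c\<close>.  Such an \<open>A\<close> is determined by the kernel of this map, which is an
  equivalence relation closed under descent, and every such relation \<open>E\<close> occurs: the closure of
  \<open>R\<close> is the kernel of the map to the sheaf associated with \<open>yoneda C c\<close> modulo \<open>R\<close>.  On the other
  hand every arrow \<open>f : c \<rightarrow> d\<close> is locally surjective as a map of representables, so \<open>A\<close> is
  isomorphic to \<open>l(d)\<close> iff the kernel of \<open>x\<close> is the kernel of some \<open>f\<close>.
\<close>

section \<open>Natural transformations and isomorphisms of sheaves\<close>

text \<open>Two features shape the work. \<open>C\<close> need not have pullbacks, so kernel pairs
  are replaced by all pairs of arrows equalised by \<open>h\<close>, and a section of a quotient is
  known only through its restriction along some \<open>h\<close>. Dual amalgamation supplies common
  refinements on which two such descriptions can be compared, and separatedness carries the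
  comparison back. Moreover the sheaves of the theorem have elements in \<open>'u\<close>, whereas
  representables consist of arrows and the quotient sheaf of sets of pairs. Arrows of
  \<open>Sh\<close> stay within one element type, so isomorphisms are handled as bijective natural
  transformations, which may change it. Subcanonicity identifies \<open>l(d)\<close> with
  \<open>yoneda C d\<close>; an isomorphism from a generated sheaf to \<open>l(d)\<close> then
  yields the arrow \<open>f\<close> as the image of the generating section, by Yoneda.\<close>

lemma nat_trans_Sec:
  "\<tau> \<in> nat_trans C P Q \<Longrightarrow> c \<in> Obj C \<Longrightarrow> x \<in> Sec P c \<Longrightarrow> \<tau> c x \<in> Sec Q c"
  by (auto simp: nat_trans_def dest!: PiE_mem)

lemma nat_trans_natural:
  "\<tau> \<in> nat_trans C P Q \<Longrightarrow> a \<in> Arr C \<Longrightarrow> x \<in> Sec P (Cod C a) \<Longrightarrow>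
    \<tau> (Dom C a) (Res P a x) = Res Q a (\<tau> (Cod C a) x)"
  by (auto simp: nat_trans_def)

lemma nat_trans_ext:
  assumes "\<sigma> \<in> nat_trans C P Q" "\<tau> \<in> nat_trans C P Q"
    and "\<And>c x. c \<in> Obj C \<Longrightarrow> x \<in> Sec P c \<Longrightarrow> \<sigma> c x = \<tau> c x"
  shows "\<sigma> = \<tau>"
proof (rule PiE_ext[of _ "Obj C" "\<lambda>c. Sec P c \<rightarrow>\<^sub>E Sec Q c"])
  show s: "\<sigma> \<in> (\<Pi>\<^sub>E c\<in>Obj C. Sec P c \<rightarrow>\<^sub>E Sec Q c)" and t: "\<tau> \<in> (\<Pi>\<^sub>E c\<in>Obj C. Sec P c \<rightarrow>\<^sub>E Sec Q c)"
    using assms by (simp_all add: nat_trans_def)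
  fix c assume "c \<in> Obj C"
  then show "\<sigma> c = \<tau> c" by (intro PiE_ext[OF PiE_mem[OF s] PiE_mem[OF t]] assms(3))
qed

lemma nt_comp_apply [simp]:
  "c \<in> Obj C \<Longrightarrow> x \<in> Sec P c \<Longrightarrow> nt_comp C P \<sigma> \<tau> c x = \<sigma> c (\<tau> c x)"
  by (simp add: nt_comp_def compose_def)

lemma nt_id_apply [simp]: "c \<in> Obj C \<Longrightarrow> x \<in> Sec P c \<Longrightarrow> nt_id C P c x = x"
  by (simp add: nt_id_def)

lemma is_sheaf_presheaf: "is_sheaf C J F \<Longrightarrow> is_presheaf C F"
  by (simp add: is_sheaf_def)

lemma Res_Sec:
  "is_presheaf C P \<Longrightarrow> a \<in> Arr C \<Longrightarrow> x \<in> Sec P (Cod C a) \<Longrightarrow> Res P a x \<in> Sec P (Dom C a)"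
  by (simp add: is_presheaf_def)

lemma Res_Ident: "is_presheaf C P \<Longrightarrow> c \<in> Obj C \<Longrightarrow> x \<in> Sec P c \<Longrightarrow> Res P (Ident C c) x = x"
  by (simp add: is_presheaf_def)

lemma Res_Comp:
  "is_presheaf C P \<Longrightarrow> a \<in> Arr C \<Longrightarrow> b \<in> Arr C \<Longrightarrow> Cod C b = Dom C a \<Longrightarrow> x \<in> Sec P (Cod C a)
    \<Longrightarrow> Res P (a \<odot>\<^bsub>C\<^esub> b) x = Res P b (Res P a x)"
  by (simp add: is_presheaf_def)

lemma Sec_yoneda: "Sec (yoneda C c) e = hom C e c"
  by (simp add: yoneda_def)

lemma Res_yoneda: "Res (yoneda C c) a g = g \<odot>\<^bsub>C\<^esub> a"
  by (simp add: yoneda_def)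

context category
begin

lemma comp_simps [simp]:
  assumes "f \<in> Arr C" "g \<in> Arr C" "Cod C f = Dom C g"
  shows "g \<odot> f \<in> Arr C" "Dom C (g \<odot> f) = Dom C f" "Cod C (g \<odot> f) = Cod C g"
  using Comp_hom[of f "Dom C f" "Dom C g" g "Cod C g"] assms by (auto simp: hom_def)

lemma comp_assoc [simp]:
  "f \<in> Arr C \<Longrightarrow> g \<in> Arr C \<Longrightarrow> h \<in> Arr C \<Longrightarrow> Cod C f = Dom C g \<Longrightarrow> Cod C g = Dom C h
    \<Longrightarrow> (h \<odot> g) \<odot> f = h \<odot> (g \<odot> f)"
  using Comp_assoc[of f "Dom C f" "Dom C g" g "Dom C h" h "Cod C h"] by (auto simp: hom_def)

lemma Ident_simps [simp]:
  assumes "c \<in> Obj C"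
  shows "Ident C c \<in> Arr C" "Dom C (Ident C c) = c" "Cod C (Ident C c) = c"
  using Ident_hom[OF assms] by (auto simp: hom_def)

lemma comp_Ident [simp]:
  "f \<in> Arr C \<Longrightarrow> Dom C f = c \<Longrightarrow> f \<odot> Ident C c = f"
  "f \<in> Arr C \<Longrightarrow> Cod C f = c \<Longrightarrow> Ident C c \<odot> f = f"
  using Ident_left[of f] Ident_right[of f] by (auto simp: hom_def)

declare Dom_Obj [simp] Cod_Obj [simp]

end

lemma nat_transI:
  assumes "category C" "is_presheaf C P"
    and "\<And>c x. c \<in> Obj C \<Longrightarrow> x \<in> Sec P c \<Longrightarrow> t c x \<in> Sec Q c"
    and "\<And>a x. a \<in> Arr C \<Longrightarrow> x \<in> Sec P (Cod C a) \<Longrightarrow>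
      t (Dom C a) (Res P a x) = Res Q a (t (Cod C a) x)"
  shows "(\<lambda>c\<in>Obj C. \<lambda>x\<in>Sec P c. t c x) \<in> nat_trans C P Q"
proof -
  interpret category C by fact
  show ?thesis
    unfolding nat_trans_def
  proof (intro CollectI conjI ballI)
    show "(\<lambda>c\<in>Obj C. \<lambda>x\<in>Sec P c. t c x) \<in> (\<Pi>\<^sub>E c\<in>Obj C. Sec P c \<rightarrow>\<^sub>E Sec Q c)"
      using assms(3) by simp
  qed (simp add: assms(4) Res_Sec[OF assms(2)])
qed

lemma nt_comp_nat_trans:
  assumes "category C" "is_presheaf C P" "\<tau> \<in> nat_trans C P Q" "\<sigma> \<in> nat_trans C Q R"
  shows "nt_comp C P \<sigma> \<tau> \<in> nat_trans C P R"
proof -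
  have "(\<lambda>c\<in>Obj C. \<lambda>x\<in>Sec P c. \<sigma> c (\<tau> c x)) \<in> nat_trans C P R"
  proof (rule nat_transI[OF assms(1,2)])
    show "\<sigma> c (\<tau> c x) \<in> Sec R c" if "c \<in> Obj C" "x \<in> Sec P c" for c x
      using that nat_trans_Sec[OF assms(3)] nat_trans_Sec[OF assms(4)] by blast
    show "\<sigma> (Dom C a) (\<tau> (Dom C a) (Res P a x)) = Res R a (\<sigma> (Cod C a) (\<tau> (Cod C a) x))"
      if "a \<in> Arr C" "x \<in> Sec P (Cod C a)" for a x
      using that nat_trans_natural[OF assms(3) that] nat_trans_Sec[OF assms(3) _ that(2)]
        category.Cod_Obj[OF assms(1) that(1)] nat_trans_natural[OF assms(4) that(1)] by simp
  qed
  moreover have "(\<lambda>c\<in>Obj C. \<lambda>x\<in>Sec P c. \<sigma> c (\<tau> c x)) = nt_comp C P \<sigma> \<tau>"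
    by (simp add: nt_comp_def compose_def)
  ultimately show ?thesis by simp
qed

lemma nt_id_nat_trans: "category C \<Longrightarrow> is_presheaf C P \<Longrightarrow> nt_id C P \<in> nat_trans C P P"
  unfolding nt_id_def by (intro nat_transI) auto

text \<open>Isomorphism in a form that allows \<open>P\<close> and \<open>Q\<close> to have
  different element types, which \<open>isomorphic (Sh C J)\<close> cannot express. No inverse is
  demanded; it is recovered in \<open>nat_bij_inverse\<close>.\<close>

definition nat_bij where
  "nat_bij C P Q \<tau> \<longleftrightarrow> \<tau> \<in> nat_trans C P Q \<and> (\<forall>c\<in>Obj C. bij_betw (\<tau> c) (Sec P c) (Sec Q c))"

text \<open>Serves maps whose values are known only through choices: the relation admits all choices
  at once, and well-definedness becomes a property of it. The equivalence in \<open>inj\<close> says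
  in one direction that \<open>T\<close> is single-valued, in the other that it is
  injective.\<close>

lemma nat_bij_of_relation:
  assumes "category C" "is_presheaf C P"
    and T: "\<And>c x y. T c x y \<Longrightarrow> x \<in> Sec P c \<and> y \<in> Sec Q c"
    and total: "\<And>c x. c \<in> Obj C \<Longrightarrow> x \<in> Sec P c \<Longrightarrow> \<exists>y. T c x y"
    and onto: "\<And>c y. c \<in> Obj C \<Longrightarrow> y \<in> Sec Q c \<Longrightarrow> \<exists>x. T c x y"
    and inj: "\<And>c x y x' y'. c \<in> Obj C \<Longrightarrow> T c x y \<Longrightarrow> T c x' y' \<Longrightarrow> x = x' \<longleftrightarrow> y = y'"
    and natural: "\<And>a x y. a \<in> Arr C \<Longrightarrow> T (Cod C a) x y \<Longrightarrow> T (Dom C a) (Res P a x) (Res Q a y)"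
  shows "\<exists>\<tau>. nat_bij C P Q \<tau> \<and> (\<forall>c\<in>Obj C. \<forall>x\<in>Sec P c. T c x (\<tau> c x))"
proof -
  interpret category C by fact
  define t where "t c x = (SOME y. T c x y)" for c x
  have t: "T c x (t c x)" if "c \<in> Obj C" "x \<in> Sec P c" for c x
    unfolding t_def using total[OF that] by (rule someI_ex)
  define \<tau> where "\<tau> = (\<lambda>c\<in>Obj C. \<lambda>x\<in>Sec P c. t c x)"
  have \<tau>: "\<tau> c x = t c x" if "c \<in> Obj C" "x \<in> Sec P c" for c x
    using that by (simp add: \<tau>_def)
  have "\<tau> \<in> nat_trans C P Q"
    unfolding \<tau>_def
  proof (rule nat_transI[OF assms(1,2)])
    show "t c x \<in> Sec Q c" if "c \<in> Obj C" "x \<in> Sec P c" for c x using t[OF that] T by blast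
    fix a x assume a: "a \<in> Arr C" "x \<in> Sec P (Cod C a)"
    have "T (Dom C a) (Res P a x) (Res Q a (t (Cod C a) x))" using a t natural by simp
    moreover have "T (Dom C a) (Res P a x) (t (Dom C a) (Res P a x))"
      using a t Res_Sec[OF assms(2)] by simp
    ultimately show "t (Dom C a) (Res P a x) = Res Q a (t (Cod C a) x)"
      using inj a(1) Dom_Obj by blast
  qed
  moreover have "bij_betw (\<tau> c) (Sec P c) (Sec Q c)" if c: "c \<in> Obj C" for c
  proof (rule bij_betw_imageI)
    show "inj_on (\<tau> c) (Sec P c)"
      using c t inj by (intro inj_onI) (metis \<tau>)
    show "\<tau> c ` Sec P c = Sec Q c"
    proof (intro equalityI subsetI)
      show "y \<in> Sec Q c" if "y \<in> \<tau> c ` Sec P c" for y using that c t T \<tau> by force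
      fix y assume "y \<in> Sec Q c"
      then obtain x where x: "T c x y" using onto c by blast
      then have "x \<in> Sec P c" using T by blast
      moreover from this have "y = \<tau> c x" using x t[OF c] inj[OF c] \<tau>[OF c] by metis
      ultimately show "y \<in> \<tau> c ` Sec P c" by blast
    qed
  qed
  ultimately show ?thesis using t \<tau> unfolding nat_bij_def by metis
qed

lemma nat_bij_inverse:
  assumes "category C" "is_presheaf C P" "is_presheaf C Q" "nat_bij C P Q \<tau>"
  shows "\<exists>\<sigma>. nat_bij C Q P \<sigma> \<and> (\<forall>c\<in>Obj C. \<forall>x\<in>Sec P c. \<sigma> c (\<tau> c x) = x)
    \<and> (\<forall>c\<in>Obj C. \<forall>y\<in>Sec Q c. \<tau> c (\<sigma> c y) = y)"
proof -
  have \<tau>: "\<tau> \<in> nat_trans C P Q" and b: "\<And>c. c \<in> Obj C \<Longrightarrow> bij_betw (\<tau> c) (Sec P c) (Sec Q c)"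
    using assms(4) by (auto simp: nat_bij_def)
  have i: "x = x'" if "c \<in> Obj C" "x \<in> Sec P c" "x' \<in> Sec P c" "\<tau> c x = \<tau> c x'" for c x x'
    using b that by (meson bij_betw_imp_inj_on inj_onD)
  have s: "\<exists>x\<in>Sec P c. y = \<tau> c x" if "c \<in> Obj C" "y \<in> Sec Q c" for c y
    using b[OF that(1)] that(2) by (auto simp: bij_betw_def)
  let ?T = "\<lambda>c y x. c \<in> Obj C \<and> x \<in> Sec P c \<and> y \<in> Sec Q c \<and> y = \<tau> c x"
  have "\<exists>\<sigma>. nat_bij C Q P \<sigma> \<and> (\<forall>c\<in>Obj C. \<forall>y\<in>Sec Q c. ?T c y (\<sigma> c y))"
  proof (rule nat_bij_of_relation[OF assms(1,3)])
    show "\<exists>x. ?T c y x" if "c \<in> Obj C" "y \<in> Sec Q c" for c y using s[OF that] that by blast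
    show "\<exists>y. ?T c y x" if "c \<in> Obj C" "x \<in> Sec P c" for c x using nat_trans_Sec[OF \<tau>] that by blast
    show "?T (Dom C a) (Res Q a y) (Res P a x)" if "a \<in> Arr C" "?T (Cod C a) y x" for a x y
      using that nat_trans_natural[OF \<tau>] assms(1-3)
      by (auto simp: Res_Sec category.Dom_Obj)
  qed (use i in blast)+
  then obtain \<sigma> where \<sigma>: "nat_bij C Q P \<sigma>" "\<forall>c\<in>Obj C. \<forall>y\<in>Sec Q c. ?T c y (\<sigma> c y)" by blast
  then have "\<sigma> c (\<tau> c x) = x" if "c \<in> Obj C" "x \<in> Sec P c" for c x
    using i nat_trans_Sec[OF \<tau>] that by metis
  with \<sigma> show ?thesis by metis
qed

lemma nat_bij_comp:
  assumes "category C" "is_presheaf C P" "nat_bij C P Q \<tau>" "nat_bij C Q R \<sigma>"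
  shows "nat_bij C P R (nt_comp C P \<sigma> \<tau>)"
proof -
  have "bij_betw (nt_comp C P \<sigma> \<tau> c) (Sec P c) (Sec R c)" if "c \<in> Obj C" for c
    using bij_betw_trans[of "\<tau> c" "Sec P c" "Sec Q c" "\<sigma> c" "Sec R c"] assms that
    by (subst bij_betw_cong[of _ _ "\<sigma> c \<circ> \<tau> c"]) (auto simp: nat_bij_def)
  then show ?thesis using nt_comp_nat_trans assms by (auto simp: nat_bij_def)
qed

lemma isomorphism_Sh_iff:
  assumes "category C" "is_sheaf C J F" "is_sheaf C J G" "\<tau> \<in> nat_trans C F G"
  shows "isomorphism (Sh C J) (F, \<tau>, G) \<longleftrightarrow> nat_bij C F G \<tau>"
proof
  assume "isomorphism (Sh C J) (F, \<tau>, G)"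
  then obtain \<sigma> where \<sigma>: "\<sigma> \<in> nat_trans C G F"
    and 1: "nt_comp C F \<sigma> \<tau> = nt_id C F" and 2: "nt_comp C G \<tau> \<sigma> = nt_id C G"
    by (auto simp: isomorphism_def Sh_def hom_def)
  have "bij_betw (\<tau> c) (Sec F c) (Sec G c)" if c: "c \<in> Obj C" for c
  proof (rule bij_betw_byWitness[where f' = "\<sigma> c"])
    show "\<forall>x\<in>Sec F c. \<sigma> c (\<tau> c x) = x"
    proof
      fix x assume "x \<in> Sec F c"
      then show "\<sigma> c (\<tau> c x) = x" using 1 c by (metis nt_comp_apply nt_id_apply)
    qed
    show "\<forall>x\<in>Sec G c. \<tau> c (\<sigma> c x) = x"
    proof
      fix x assume "x \<in> Sec G c"
      then show "\<tau> c (\<sigma> c x) = x" using 2 c by (metis nt_comp_apply nt_id_apply)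
    qed
    show "\<tau> c ` Sec F c \<subseteq> Sec G c" using nat_trans_Sec[OF assms(4) c] by blast
    show "\<sigma> c ` Sec G c \<subseteq> Sec F c" using nat_trans_Sec[OF \<sigma> c] by blast
  qed
  then show "nat_bij C F G \<tau>" using assms(4) by (simp add: nat_bij_def)
next
  assume b: "nat_bij C F G \<tau>"
  have p: "is_presheaf C F" "is_presheaf C G" using assms by (auto simp: is_sheaf_def)
  obtain \<sigma> where \<sigma>: "nat_bij C G F \<sigma>" "\<forall>c\<in>Obj C. \<forall>x\<in>Sec F c. \<sigma> c (\<tau> c x) = x"
    "\<forall>c\<in>Obj C. \<forall>y\<in>Sec G c. \<tau> c (\<sigma> c y) = y"
    using nat_bij_inverse[OF assms(1) p b] by blast
  have s: "\<sigma> \<in> nat_trans C G F" using \<sigma>(1) by (simp add: nat_bij_def)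
  have "nt_comp C F \<sigma> \<tau> = nt_id C F"
    by (rule nat_trans_ext[OF nt_comp_nat_trans[OF assms(1) p(1) assms(4) s]
          nt_id_nat_trans[OF assms(1) p(1)]]) (simp add: \<sigma>)
  moreover have "nt_comp C G \<tau> \<sigma> = nt_id C G"
    by (rule nat_trans_ext[OF nt_comp_nat_trans[OF assms(1) p(2) s assms(4)]
          nt_id_nat_trans[OF assms(1) p(2)]]) (simp add: \<sigma>)
  ultimately have "(G, \<sigma>, F) \<in> hom (Sh C J) G F" "nt_comp C F \<sigma> \<tau> = nt_id C F"
    "nt_comp C G \<tau> \<sigma> = nt_id C G"
    using s assms by (auto simp: Sh_def hom_def)
  then show "isomorphism (Sh C J) (F, \<tau>, G)"
    unfolding isomorphism_def using assms
    by (intro conjI bexI[of _ "(G, \<sigma>, F)"]) (auto simp: Sh_def)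
qed

lemma isomorphic_Sh_iff:
  assumes "category C" "is_sheaf C J F" "is_sheaf C J G"
  shows "isomorphic (Sh C J) F G \<longleftrightarrow> (\<exists>\<tau>. nat_bij C F G \<tau>)"
proof -
  have "isomorphic (Sh C J) F G
    \<longleftrightarrow> (\<exists>\<tau>\<in>nat_trans C F G. isomorphism (Sh C J) (F, \<tau>, G))"
    using assms by (auto simp: isomorphic_def hom_def Sh_def)
  then show ?thesis using isomorphism_Sh_iff[OF assms] by (auto simp: nat_bij_def)
qed

text \<open>The usual argument: both composites of the comparison maps agree with an identity after
  \<open>\<eta>\<close> or \<open>\<eta>'\<close>. The two sheaves share the element type
  \<open>'y\<close> because the universal property tests only against sheaves of that type.\<close>

lemma sheafification_unique:
  fixes P :: "('o, 'a, 'x) presheaf" and L L' :: "('o, 'a, 'y) presheaf"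
  assumes "category C" "is_presheaf C P" "sheafification C J P L \<eta>" "sheafification C J P L' \<eta>'"
  shows "\<exists>\<psi>. nat_bij C L L' \<psi> \<and> nt_comp C P \<psi> \<eta> = \<eta>'"
proof -
  have L: "is_sheaf C J L" "is_sheaf C J L'" "\<eta> \<in> nat_trans C P L" "\<eta>' \<in> nat_trans C P L'"
    using assms by (auto simp: sheafification_def)
  have p: "is_presheaf C L" "is_presheaf C L'" using L is_sheaf_presheaf by auto
  have ex: "\<exists>\<psi>. \<psi> \<in> nat_trans C L1 L2 \<and> nt_comp C P \<psi> \<eta>1 = \<eta>2"
    and un: "\<And>\<psi> \<phi>. \<psi> \<in> nat_trans C L1 L2 \<Longrightarrow> nt_comp C P \<psi> \<eta>1 = \<eta>2 \<Longrightarrow>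
      \<phi> \<in> nat_trans C L1 L2 \<Longrightarrow> nt_comp C P \<phi> \<eta>1 = \<eta>2 \<Longrightarrow> \<psi> = \<phi>"
    if "sheafification C J P L1 \<eta>1" "is_sheaf C J L2" "\<eta>2 \<in> nat_trans C P L2"
    for L1 L2 :: "('o, 'a, 'y) presheaf" and \<eta>1 \<eta>2
    using that unfolding sheafification_def by blast+
  obtain \<psi> where \<psi>: "\<psi> \<in> nat_trans C L L'" "nt_comp C P \<psi> \<eta> = \<eta>'"
    using ex[OF assms(3) L(2,4)] by blast
  obtain \<phi> where \<phi>: "\<phi> \<in> nat_trans C L' L" "nt_comp C P \<phi> \<eta>' = \<eta>"
    using ex[OF assms(4) L(1,3)] by blast
  have id: "nt_comp C P (nt_comp C L1 g f) \<eta>1 = \<eta>1"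
    if "nt_comp C P f \<eta>1 = \<eta>2" "nt_comp C P g \<eta>2 = \<eta>1" "\<eta>1 \<in> nat_trans C P L1"
       "f \<in> nat_trans C L1 L2" "g \<in> nat_trans C L2 L1" "is_presheaf C L1" 
    for f g \<eta>1 \<eta>2 and L1 L2 :: "('o, 'a, 'y) presheaf"
  proof (rule nat_trans_ext[OF _ that(3)])
    show "nt_comp C P (nt_comp C L1 g f) \<eta>1 \<in> nat_trans C P L1"
      by (rule nt_comp_nat_trans[OF assms(1,2) that(3) nt_comp_nat_trans[OF assms(1) that(6,4,5)]])
    fix c x assume c: "c \<in> Obj C" "x \<in> Sec P c"
    have "f c (\<eta>1 c x) = \<eta>2 c x" using that(1) c nt_comp_apply[of c C x P f \<eta>1] by simp
    moreover have "g c (\<eta>2 c x) = \<eta>1 c x" using that(2) c nt_comp_apply[of c C x P g \<eta>2] by simp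
    ultimately show "nt_comp C P (nt_comp C L1 g f) \<eta>1 c x = \<eta>1 c x"
      using c nat_trans_Sec[OF that(3)] by simp
  qed
  have idn: "nt_comp C P (nt_id C L1) \<eta>1 = \<eta>1"
    if "\<eta>1 \<in> nat_trans C P L1" "is_presheaf C L1" for \<eta>1 and L1 :: "('o, 'a, 'y) presheaf"
    by (rule nat_trans_ext[OF nt_comp_nat_trans[OF assms(1,2) that(1) nt_id_nat_trans[OF assms(1) that(2)]] that(1)])
      (simp add: nat_trans_Sec[OF that(1)])
  have 1: "nt_comp C L \<phi> \<psi> = nt_id C L"
    using un[OF assms(3) L(1,3) _ id[OF \<psi>(2) \<phi>(2) L(3) \<psi>(1) \<phi>(1) p(1)] _ idn[OF L(3) p(1)]]
      nt_comp_nat_trans[OF assms(1) p(1) \<psi>(1) \<phi>(1)] nt_id_nat_trans[OF assms(1) p(1)] by blast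
  have 2: "nt_comp C L' \<psi> \<phi> = nt_id C L'"
    using un[OF assms(4) L(2,4) _ id[OF \<phi>(2) \<psi>(2) L(4) \<phi>(1) \<psi>(1) p(2)] _ idn[OF L(4) p(2)]]
      nt_comp_nat_trans[OF assms(1) p(2) \<phi>(1) \<psi>(1)] nt_id_nat_trans[OF assms(1) p(2)] by blast
  have "isomorphism (Sh C J) (L, \<psi>, L')"
    unfolding isomorphism_def using L \<psi>(1) \<phi>(1) 1 2
    by (auto simp: Sh_def hom_def intro!: exI[of _ \<phi>])
  then show ?thesis using isomorphism_Sh_iff[OF assms(1) L(1,2) \<psi>(1)] \<psi>(2) by blast
qed

text \<open>\<open>l_obj\<close> is a choice of which only the universal property is known. By
  subcanonicity the representable is already a sheaf, so its copy relabelled along \<open>i\<close>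
  is another sheafification with elements in \<open>'u\<close>, and uniqueness compares the
  two.\<close>

lemma l_obj_nat_bij:
  fixes C :: "('o, 'a) cat" and i :: "'a \<Rightarrow> 'u"
  assumes "category C" "subcanonical C J" "c \<in> Obj C" "inj i"
  shows "is_sheaf C J (l_obj C J c :: ('o, 'a, 'u) presheaf)"
    and "\<exists>\<eta>. nat_bij C (yoneda C c) (l_obj C J c :: ('o, 'a, 'u) presheaf) \<eta>"
proof -
  let ?L = "l_obj C J c :: ('o, 'a, 'u) presheaf" and ?y = "yoneda C c"
  have y: "is_sheaf C J ?y" using assms(2,3) by (simp add: subcanonical_def)
  have py: "is_presheaf C ?y" using y by (rule is_sheaf_presheaf)
  obtain \<eta> where \<eta>: "sheafification C J ?y ?L \<eta>"
    using l_obj_sheafification[OF assms] by blast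
  then show "is_sheaf C J ?L" by (simp add: sheafification_def)
  define L0 :: "('o, 'a, 'u) presheaf"
    where "L0 = \<lparr>Sec = (\<lambda>c. i ` Sec ?y c), Res = (\<lambda>a y. i (Res ?y a (inv i y)))\<rparr>"
  define \<eta>0 where "\<eta>0 = (\<lambda>c\<in>Obj C. \<lambda>x\<in>Sec ?y c. i x)"
  have s0: "sheafification C J ?y L0 \<eta>0"
    unfolding L0_def \<eta>0_def by (rule sheafification_of_sheaf[OF assms(1) y assms(4)])
  have "bij_betw (\<eta>0 e) (Sec ?y e) (Sec L0 e)" if "e \<in> Obj C" for e
    using that assms(4)
    by (auto simp: \<eta>0_def L0_def bij_betw_def inj_on_def dest: injD)
  then have b0: "nat_bij C ?y L0 \<eta>0" using s0 by (simp add: nat_bij_def sheafification_def)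
  obtain \<psi> where "nat_bij C L0 ?L \<psi>" using sheafification_unique[OF assms(1) py s0 \<eta>] by blast
  then show "\<exists>\<eta>. nat_bij C ?y ?L \<eta>" using nat_bij_comp[OF assms(1) py b0] by blast
qed

section \<open>Sheaves for the atomic topology\<close>

locale ore_category = category C for C :: "('o, 'a) cat" (structure) +
  assumes ore: "dual_amalgamation C"
begin

lemma ore_square:
  assumes "f \<in> Arr C" "g \<in> Arr C" "Cod C f = Cod C g"
  obtains h k where "h \<in> Arr C" "k \<in> Arr C" "Cod C h = Dom C f" "Cod C k = Dom C g"
    "Dom C h = Dom C k" "f \<odot> h = g \<odot> k"
  using ore assms unfolding dual_amalgamation_def hom_def by force

text \<open>The compatibility condition of a matching family on the sieve generated by
  \<open>h\<close>: it is the equaliser condition over the kernel pair of \<open>h\<close>, stated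
  without assuming that this pullback exists.\<close>

definition descends :: "('o, 'a, 'x) presheaf \<Rightarrow> 'a \<Rightarrow> 'x \<Rightarrow> bool" where
  "descends F h y \<longleftrightarrow> (\<forall>u\<in>Arr C. \<forall>v\<in>Arr C. Cod C u = Dom C h \<longrightarrow> Cod C v = Dom C h \<longrightarrow>
    h \<odot> u = h \<odot> v \<longrightarrow> Res F u y = Res F v y)"

text \<open>The sieve generated by \<open>h\<close> is non-empty, hence covering, and
  \<open>y\<close> extends to the matching family sending \<open>h \<odot> u\<close> to
  \<open>Res F u y\<close>.\<close>

lemma sheaf_descent:
  assumes F: "is_sheaf C (atomic_topology C) F"
    and h: "h \<in> Arr C" "y \<in> Sec F (Dom C h)" "descends F h y"
  shows "\<exists>!x. x \<in> Sec F (Cod C h) \<and> Res F h x = y"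
proof -
  have p: "is_presheaf C F" using F by (rule is_sheaf_presheaf)
  define S where "S = {h \<odot> u | u. u \<in> Arr C \<and> Cod C u = Dom C h}"
  \<comment> \<open>The factor \<open>u\<close> of \<open>k\<close> through \<open>h\<close> is
    chosen arbitrarily; since \<open>y\<close> descends, the value does not depend on the
    choice.\<close>
  define s where "s k = Res F (SOME u. u \<in> Arr C \<and> Cod C u = Dom C h \<and> h \<odot> u = k) y" for k
  have s: "s (h \<odot> u) = Res F u y" if "u \<in> Arr C" "Cod C u = Dom C h" for u
  proof -
    let ?P = "\<lambda>v. v \<in> Arr C \<and> Cod C v = Dom C h \<and> h \<odot> v = h \<odot> u"
    have "?P (SOME v. ?P v)" using that by (intro someI[of ?P u]) simp
    then show ?thesis using h(3) that unfolding s_def descends_def by blast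
  qed
  have hS: "h \<in> S" using h(1) unfolding S_def by (intro CollectI exI[of _ "Ident C (Dom C h)"]) simp
  have "sieve C (Cod C h) S"
    unfolding sieve_def S_def using h(1) by (auto intro!: comp_assoc exI[of _ "_ \<odot> _"])
  then have S: "S \<in> atomic_topology C (Cod C h)" using hS by (auto simp: atomic_topology_def)
  have "matching_family C F S s"
    unfolding matching_family_def S_def using h(1,2) p
    by (auto simp: s Res_Comp Res_Sec)
  then have ex: "\<exists>!x. x \<in> Sec F (Cod C h) \<and> (\<forall>f\<in>S. Res F f x = s f)"
    using F S h(1) unfolding is_sheaf_def by simp
  have sh: "s h = y" using s[of "Ident C (Dom C h)"] h p by (simp add: Res_Ident)
  have "(\<forall>f\<in>S. Res F f x = s f) \<longleftrightarrow> Res F h x = y" if "x \<in> Sec F (Cod C h)" for x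
    using hS sh h(1) p that by (auto simp: S_def s Res_Comp)
  then show ?thesis using ex by metis
qed

text \<open>A covering sieve contains some \<open>h\<close>, and the value of a matching family at
  \<open>h\<close> descends, which gives the only possible gluing \<open>x\<close>. For any other
  \<open>f\<close> in the sieve an Ore square over \<open>f\<close> and \<open>h\<close> shows that
  \<open>Res F f x\<close> and \<open>s f\<close> agree after a further restriction.\<close>

lemma sheafI_descent:
  assumes p: "is_presheaf C F"
    and descent: "\<And>h y. h \<in> Arr C \<Longrightarrow> y \<in> Sec F (Dom C h) \<Longrightarrow> descends F h y \<Longrightarrow>
      \<exists>!x. x \<in> Sec F (Cod C h) \<and> Res F h x = y"
  shows "is_sheaf C (atomic_topology C) F"
  unfolding is_sheaf_def
proof (intro conjI p ballI allI impI)
  fix c S s assume c: "c \<in> Obj C" and S: "S \<in> atomic_topology C c" and m: "matching_family C F S s"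
  have s: "s f \<in> Sec F (Dom C f)" if "f \<in> S" for f using m that by (simp add: matching_family_def)
  have r: "s (f \<odot> g) = Res F g (s f)" if "f \<in> S" "g \<in> Arr C" "Cod C g = Dom C f" for f g
    using m that by (simp add: matching_family_def)
  have A: "f \<in> Arr C" "Cod C f = c" if "f \<in> S" for f
    using S that by (auto simp: atomic_topology_def sieve_def)
  obtain h where h: "h \<in> S" using S by (auto simp: atomic_topology_def)
  have "descends F h (s h)" unfolding descends_def using r[OF h] by metis
  then have ex: "\<exists>!x. x \<in> Sec F c \<and> Res F h x = s h"
    using descent[of h "s h"] A[OF h] s[OF h] by simp
  have "Res F f x = s f" if x: "x \<in> Sec F c" "Res F h x = s h" and f: "f \<in> S" for x f
  proof -
    obtain p' q where pq: "p' \<in> Arr C" "q \<in> Arr C" "Cod C p' = Dom C f" "Cod C q = Dom C h"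
      "Dom C p' = Dom C q" "f \<odot> p' = h \<odot> q"
      using ore_square[of f h] A f h by metis
    have 1: "Res F p' (Res F f x) = Res F (f \<odot> p') x" using pq(1-5) A[OF f] p x by (simp add: Res_Comp)
    also have "\<dots> = Res F q (s h)"
      unfolding pq(6) using pq(1-5) A[OF h] p x by (simp add: Res_Comp)
    also have "\<dots> = s (f \<odot> p')" using r[OF h] pq by simp
    also have "\<dots> = Res F p' (s f)" using r[OF f pq(1,3)] .
    finally have e: "Res F p' (Res F f x) = Res F p' (s f)" .
    have sf: "Res F p' (s f) \<in> Sec F (Dom C p')" using s[OF f] pq(3) Res_Sec[OF p pq(1)] by simp
    \<comment> \<open>A restriction along \<open>p'\<close> always descends along \<open>p'\<close>,
      so the uniqueness part of \<open>descent\<close> makes \<open>Res F p'\<close> injective on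
      the sections over \<open>Cod C p'\<close>.\<close>
    have "descends F p' (Res F p' (s f))"
      unfolding descends_def using pq s[OF f] p by (metis Res_Comp)
    then have "\<exists>!x. x \<in> Sec F (Cod C p') \<and> Res F p' x = Res F p' (s f)"
      using descent pq(1) sf by blast
    moreover have "Res F f x \<in> Sec F (Cod C p')" "s f \<in> Sec F (Cod C p')"
      using pq A[OF f] s[OF f] x p Res_Sec[of C F f x] by simp_all
    ultimately show ?thesis using e by blast
  qed
  then show "\<exists>!x. x \<in> Sec F c \<and> (\<forall>f\<in>S. Res F f x = s f)" using ex h by metis
qed

lemma sheaf_separated:
  assumes F: "is_sheaf C (atomic_topology C) F" and "h \<in> Arr C"
    and x: "x \<in> Sec F (Cod C h)" "x' \<in> Sec F (Cod C h)" "Res F h x = Res F h x'"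
  shows "x = x'"
proof -
  have p: "is_presheaf C F" using F by (rule is_sheaf_presheaf)
  have "descends F h (Res F h x)"
    unfolding descends_def using assms p by (metis Res_Comp)
  then show ?thesis using sheaf_descent[OF F] assms p Res_Sec by metis
qed

text \<open>The preimage \<open>b\<close> of \<open>Res A h y\<close> descends in \<open>B\<close>
  because its image descends in \<open>A\<close> and \<open>m\<close> is injective. Its gluing in
  \<open>B\<close> is mapped to a section with the same restriction along \<open>h\<close> as
  \<open>y\<close>, hence to \<open>y\<close> by separatedness.\<close>

lemma mono_image_closed:
  assumes B: "is_sheaf C (atomic_topology C) B" and A: "is_sheaf C (atomic_topology C) A"
    and m: "m \<in> nat_trans C B A"
    and inj: "\<And>e. e \<in> Obj C \<Longrightarrow> inj_on (m e) (Sec B e)"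
    and h: "h \<in> Arr C" and y: "y \<in> Sec A (Cod C h)" and im: "Res A h y \<in> m (Dom C h) ` Sec B (Dom C h)"
  shows "y \<in> m (Cod C h) ` Sec B (Cod C h)"
proof -
  have p: "is_presheaf C B" "is_presheaf C A" using A B is_sheaf_presheaf by auto
  obtain b where b: "b \<in> Sec B (Dom C h)" "m (Dom C h) b = Res A h y" using im by auto
  have "Res B u b = Res B v b"
    if uv: "u \<in> Arr C" "v \<in> Arr C" "Cod C u = Dom C h" "Cod C v = Dom C h" "h \<odot> u = h \<odot> v" for u v
  proof -
    have d: "Dom C u = Dom C v" using uv h comp_simps(2) by metis
    have "m (Dom C u) (Res B u b) = Res A (h \<odot> u) y" 
      using nat_trans_natural[OF m uv(1), of b] uv(1-4) b h y p by (simp add: Res_Comp)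
    also have "\<dots> = Res A (h \<odot> v) y" using uv by simp
    also have "\<dots> = m (Dom C u) (Res B v b)"
      using nat_trans_natural[OF m uv(2), of b] uv(1-4) b h y p d by (simp add: Res_Comp)
    finally show ?thesis
      using inj_onD[OF inj[of "Dom C u"]] uv(1-4) b d Res_Sec[OF p(1) uv(1), of b]
        Res_Sec[OF p(1) uv(2), of b] by simp
  qed
  then have "descends B h b" unfolding descends_def by blast
  then obtain x where x: "x \<in> Sec B (Cod C h)" "Res B h x = b"
    using sheaf_descent[OF B h b(1)] by blast
  have "Res A h (m (Cod C h) x) = Res A h y"
    using nat_trans_natural[OF m h x(1)] x b by simp
  then have "m (Cod C h) x = y"
    using sheaf_separated[OF A h] y nat_trans_Sec[OF m _ x(1)] h by simp
  then show ?thesis using x by blast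
qed

lemma empty_sheaf: "is_sheaf C (atomic_topology C) \<lparr>Sec = (\<lambda>_. {}), Res = r\<rparr>"
  by (rule sheafI_descent) (auto simp: is_presheaf_def)

text \<open>No covering sieve is empty, so the empty presheaf is a sheaf, and only a presheaf
  without sections maps into it. Being non-zero therefore means having a section somewhere.\<close>

lemma initial_Sh_iff:
  fixes F :: "('o, 'a, 'b) presheaf"
  assumes F: "is_sheaf C (atomic_topology C) F"
  shows "initial_object (Sh C (atomic_topology C)) F \<longleftrightarrow> (\<forall>e\<in>Obj C. Sec F e = {})"
proof
  define Z :: "('o, 'a, 'b) presheaf" where "Z = \<lparr>Sec = (\<lambda>_. {}), Res = Res F\<rparr>"
  assume "initial_object (Sh C (atomic_topology C)) F"
  moreover have "Z \<in> Obj (Sh C (atomic_topology C))" using empty_sheaf by (simp add: Z_def Sh_def)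
  ultimately obtain f where "f \<in> hom (Sh C (atomic_topology C)) F Z"
    unfolding initial_object_def by blast
  then obtain \<tau> where "\<tau> \<in> nat_trans C F Z" by (auto simp: hom_def Sh_def)
  then show "\<forall>e\<in>Obj C. Sec F e = {}" using nat_trans_Sec[of \<tau> C F Z] by (auto simp: Z_def)
next
  assume e: "\<forall>e\<in>Obj C. Sec F e = {}"
  have "\<exists>!f. f \<in> hom (Sh C (atomic_topology C)) F G" if G: "is_sheaf C (atomic_topology C) G" for G
  proof (rule ex1I)
    let ?t = "\<lambda>c\<in>Obj C. \<lambda>x\<in>Sec F c. undefined"
    have t: "?t \<in> nat_trans C F G"
      by (rule nat_transI) (use e F is_sheaf_presheaf category_axioms in auto)
    then show "(F, ?t, G) \<in> hom (Sh C (atomic_topology C)) F G"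
      using F G by (auto simp: hom_def Sh_def)
    fix f assume "f \<in> hom (Sh C (atomic_topology C)) F G"
    then obtain s where s: "f = (F, s, G)" "s \<in> nat_trans C F G" by (auto simp: hom_def Sh_def)
    moreover have "s = ?t" by (rule nat_trans_ext[OF s(2) t]) (use e in auto)
    ultimately show "f = (F, ?t, G)" by simp
  qed
  then show "initial_object (Sh C (atomic_topology C)) F"
    using F by (simp add: initial_object_def Sh_def)
qed

lemma injective_monic_Sh:
  assumes B: "is_sheaf C J B" and A: "is_sheaf C J A"
    and m: "m \<in> nat_trans C B A"
    and inj: "\<And>e. e \<in> Obj C \<Longrightarrow> inj_on (m e) (Sec B e)"
  shows "monic (Sh C J) (B, m, A)"
proof -
  have "f = g" if fg: "f \<in> hom (Sh C J) X B" "g \<in> hom (Sh C J) X B"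
    and e: "(B, m, A) \<odot>\<^bsub>Sh C J\<^esub> f = (B, m, A) \<odot>\<^bsub>Sh C J\<^esub> g" for X f g
  proof -
    obtain s t where st: "f = (X, s, B)" "s \<in> nat_trans C X B" "g = (X, t, B)" "t \<in> nat_trans C X B"
      using fg by (auto simp: hom_def Sh_def)
    have "nt_comp C X m s = nt_comp C X m t" using e st by (simp add: Sh_def)
    then have "m c (s c x) = m c (t c x)" if "c \<in> Obj C" "x \<in> Sec X c" for c x
      using that by (metis nt_comp_apply)
    then have "s = t"
      using inj st by (intro nat_trans_ext[OF st(2,4)]) (meson inj_onD nat_trans_Sec)
    then show ?thesis using st by simp
  qed
  then show ?thesis using A B m unfolding monic_def by (auto simp: Sh_def)
qed

lemma yoneda_nat_trans:
  assumes "is_presheaf C F" "x \<in> Sec F c"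
  shows "(\<lambda>e\<in>Obj C. \<lambda>a\<in>Sec (yoneda C c) e. Res F a x) \<in> nat_trans C (yoneda C c) F"
proof (rule nat_transI[OF category_axioms])
  show "is_presheaf C (yoneda C c)"
    by (auto simp: is_presheaf_def Sec_yoneda Res_yoneda hom_def)
qed (use assms in \<open>auto simp: Sec_yoneda Res_yoneda hom_def Res_Comp intro: Res_Sec\<close>)

section \<open>Atoms are the locally generated sheaves\<close>

text \<open>\<open>locally_generated F c x\<close> says that the map from \<open>yoneda C c\<close> to \<open>F\<close> corresponding
  to \<open>x\<close> is locally surjective.\<close>

definition locally_generated :: "('o, 'a, 'x) presheaf \<Rightarrow> 'o \<Rightarrow> 'x \<Rightarrow> bool" where
  "locally_generated F c x \<longleftrightarrow> x \<in> Sec F c \<and> (\<forall>e\<in>Obj C. \<forall>y\<in>Sec F e.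
    \<exists>h\<in>Arr C. \<exists>g\<in>hom C (Dom C h) c. Cod C h = e \<and> Res F h y = Res F g x)"

text \<open>Any section \<open>x\<close> of an atom generates it: the sections locally of the form
  \<open>Res A g x\<close> make up a subsheaf containing \<open>x\<close>, and this non-zero
  subobject must be everything.\<close>

lemma atom_locally_generated:
  assumes at: "atom (Sh C (atomic_topology C)) A"
  shows "\<exists>c\<in>Obj C. \<exists>x. locally_generated A c x"
proof -
  let ?J = "atomic_topology C"
  have A: "is_sheaf C ?J A" using at by (simp add: atom_def Sh_def)
  have p: "is_presheaf C A" using A by (rule is_sheaf_presheaf)
  obtain c x where c: "c \<in> Obj C" and x: "x \<in> Sec A c"
    using at initial_Sh_iff[OF A] by (auto simp: atom_def)
  \<comment> \<open>The sheaf image of the map from \<open>yoneda C c\<close> given by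
    \<open>x\<close>; the presheaf image alone need not be closed under descent.\<close>
  define D where "D e = {y \<in> Sec A e. \<exists>h\<in>Arr C. \<exists>g\<in>hom C (Dom C h) c. Cod C h = e \<and> Res A h y = Res A g x}" for e
  define B where "B = \<lparr>Sec = D, Res = Res A\<rparr>"
  \<comment> \<open>The covering arrow \<open>h\<close> for \<open>y\<close> is pulled back along
    \<open>a\<close> by an Ore square, and \<open>g\<close> is composed with the other side of
    it.\<close>
  have D1: "Res A a y \<in> D (Dom C a)" if a: "a \<in> Arr C" and y: "y \<in> D (Cod C a)" for a y
  proof -
    obtain h g where h: "h \<in> Arr C" "g \<in> Arr C" "Dom C g = Dom C h" "Cod C g = c" "Cod C h = Cod C a"
      "Res A h y = Res A g x" and yA: "y \<in> Sec A (Cod C a)"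
      using y by (auto simp: D_def hom_def)
    obtain u v where uv: "u \<in> Arr C" "v \<in> Arr C" "Cod C u = Dom C h" "Cod C v = Dom C a"
      "Dom C u = Dom C v" "h \<odot> u = a \<odot> v" using ore_square[of h a] h a by metis
    have "Res A v (Res A a y) = Res A (h \<odot> u) y" using uv a yA p by (simp add: Res_Comp)
    also have "\<dots> = Res A (g \<odot> u) x" using uv(1-5) h a yA x p by (simp add: Res_Comp)
    finally have "Res A v (Res A a y) = Res A (g \<odot> u) x" .
    moreover have "g \<odot> u \<in> hom C (Dom C v) c" using uv h by (simp add: hom_def)
    ultimately have "\<exists>h\<in>Arr C. \<exists>g\<in>hom C (Dom C h) c. Cod C h = Dom C a \<and> Res A h (Res A a y) = Res A g x"
      using uv(2,4) by blast
    then show ?thesis using Res_Sec[OF p a yA] by (simp add: D_def)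
  qed
  have pB: "is_presheaf C B"
    using p D1 unfolding is_presheaf_def B_def by (auto simp: D_def)
  have B: "is_sheaf C ?J B"
  proof (rule sheafI_descent[OF pB])
    fix h y assume h: "h \<in> Arr C" and y: "y \<in> Sec B (Dom C h)" and d: "descends B h y"
    have yD: "y \<in> D (Dom C h)" using y by (simp add: B_def)
    have "descends A h y" using d unfolding descends_def B_def presheaf.simps .
    moreover have "y \<in> Sec A (Dom C h)" using yD by (simp add: D_def)
    ultimately have ex: "\<exists>!z. z \<in> Sec A (Cod C h) \<and> Res A h z = y" using sheaf_descent[OF A h] by blast
    have "z \<in> D (Cod C h)" if z: "z \<in> Sec A (Cod C h)" "Res A h z = y" for z
    proof -
      obtain k g where k: "k \<in> Arr C" "g \<in> hom C (Dom C k) c" "Cod C k = Dom C h" "Res A k y = Res A g x"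
        using yD by (auto simp: D_def)
      have "Res A (h \<odot> k) z = Res A g x" using k h z p by (simp add: Res_Comp)
      moreover have "h \<odot> k \<in> Arr C" "Cod C (h \<odot> k) = Cod C h" "g \<in> hom C (Dom C (h \<odot> k)) c"
        using h k by simp_all
      ultimately show ?thesis using z(1) unfolding D_def by blast
    qed
    moreover have "D (Cod C h) \<subseteq> Sec A (Cod C h)" by (auto simp: D_def)
    ultimately have "\<exists>!z. z \<in> D (Cod C h) \<and> Res A h z = y" using ex by blast
    then show "\<exists>!z. z \<in> Sec B (Cod C h) \<and> Res B h z = y" by (simp add: B_def)
  qed
  define m where "m = (\<lambda>e\<in>Obj C. \<lambda>y\<in>Sec B e. y)"
  have m: "m \<in> nat_trans C B A"
    unfolding m_def by (rule nat_transI[OF category_axioms pB]) (auto simp: B_def D_def)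
  have "monic (Sh C ?J) (B, m, A)"
    by (rule injective_monic_Sh[OF B A m]) (auto simp: m_def inj_on_def)
  moreover have "Cod (Sh C ?J) (B, m, A) = A" "Dom (Sh C ?J) (B, m, A) = B"
    by (auto simp: Sh_def)
  moreover have "x \<in> Sec B c"
    using c x unfolding B_def D_def by (auto intro!: bexI[of _ "Ident C c"] Ident_hom)
  then have "\<not> initial_object (Sh C ?J) B" using initial_Sh_iff[OF B] c by auto
  ultimately have "isomorphism (Sh C ?J) (B, m, A)" using at unfolding atom_def by metis
  then have "bij_betw (m e) (Sec B e) (Sec A e)" if "e \<in> Obj C" for e
    using isomorphism_Sh_iff[OF category_axioms B A m] that by (simp add: nat_bij_def)
  then have "D e = Sec A e" if "e \<in> Obj C" for e
    using that by (force simp: bij_betw_def m_def B_def)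
  then have "locally_generated A c x" using x by (auto simp: locally_generated_def D_def)
  then show ?thesis using c by blast
qed

end

section \<open>Consequences of subcanonicity: monomorphisms, atoms and representables\<close>

locale atomic_site = ore_category C for C :: "('o, 'a) cat" (structure) +
  assumes subcanonical: "subcanonical C (atomic_topology C)"
begin

lemma sheaf_yoneda: "c \<in> Obj C \<Longrightarrow> is_sheaf C (atomic_topology C) (yoneda C c)"
  using subcanonical by (simp add: subcanonical_def)

text \<open>Precomposition with \<open>h\<close> is restriction in the representable at the common
  codomain, and that representable is separated.\<close>

lemma arrow_epic:
  assumes "h \<in> Arr C" "s \<in> Arr C" "t \<in> Arr C" "Dom C s = Cod C h" "Dom C t = Cod C h"
    and "s \<odot> h = t \<odot> h"
  shows "s = t"
proof -
  have "Cod C s = Cod C t" using assms comp_simps(3) by metis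
  then show ?thesis
    using sheaf_separated[OF sheaf_yoneda[of "Cod C s"] assms(1), of s t] assms
    by (simp add: Sec_yoneda Res_yoneda hom_def)
qed

text \<open>Maps out of \<open>l_obj C (atomic_topology C) e\<close> into a sheaf are its sections over \<open>e\<close>,
  so these objects test injectivity.\<close>

lemma monic_Sh_injective:
  fixes B A :: "('o, 'a, 'u) presheaf" and i :: "'a \<Rightarrow> 'u"
  assumes i: "inj i" and mm: "monic (Sh C (atomic_topology C)) (B, m, A)" and e: "e \<in> Obj C"
  shows "inj_on (m e) (Sec B e)"
proof (rule inj_onI)
  let ?J = "atomic_topology C" and ?y = "yoneda C e"
  let ?L = "l_obj C ?J e :: ('o, 'a, 'u) presheaf"
  fix b b' assume b: "b \<in> Sec B e" "b' \<in> Sec B e" "m e b = m e b'"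
  have B: "is_sheaf C ?J B" and A: "is_sheaf C ?J A" and m: "m \<in> nat_trans C B A"
    using mm by (auto simp: monic_def Sh_def)
  have p: "is_presheaf C B" "is_presheaf C A" "is_presheaf C ?y"
    using A B sheaf_yoneda[OF e] is_sheaf_presheaf by auto
  obtain \<eta> where \<eta>: "sheafification C ?J ?y ?L \<eta>"
    using l_obj_sheafification[OF category_axioms subcanonical e i] by blast
  then have L: "is_sheaf C ?J ?L" and \<eta>n: "\<eta> \<in> nat_trans C ?y ?L" by (auto simp: sheafification_def)
  have pL: "is_presheaf C ?L" using L by (rule is_sheaf_presheaf)
  \<comment> \<open>The map out of the representable that corresponds to the section
    \<open>z\<close> under Yoneda; it is extended along \<open>\<eta>\<close> to a map out of
    \<open>?L\<close>, and evaluation at the identity of \<open>e\<close> recovers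
    \<open>z\<close>.\<close>
  define \<phi> where "\<phi> z = (\<lambda>e'\<in>Obj C. \<lambda>a\<in>Sec ?y e'. Res B a z)" for z
  have "\<exists>\<psi>. \<psi> \<in> nat_trans C ?L B \<and> nt_comp C ?y \<psi> \<eta> = \<phi> z" if "z \<in> Sec B e" for z
    using \<eta> B yoneda_nat_trans[OF p(1) that] unfolding sheafification_def \<phi>_def by blast
  then obtain \<psi> \<psi>' where \<psi>: "\<psi> \<in> nat_trans C ?L B" "nt_comp C ?y \<psi> \<eta> = \<phi> b"
    and \<psi>': "\<psi>' \<in> nat_trans C ?L B" "nt_comp C ?y \<psi>' \<eta> = \<phi> b'" using b by metis
  let ?m = "nt_comp C ?L m \<psi>" and ?m' = "nt_comp C ?L m \<psi>'"
  have mn: "?m \<in> nat_trans C ?L A" "?m' \<in> nat_trans C ?L A"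
    using nt_comp_nat_trans[OF category_axioms pL] \<psi> \<psi>' m by auto
  have v: "nt_comp C ?y (nt_comp C ?L m \<theta>) \<eta> x a = m x (\<phi> z x a)"
    if "nt_comp C ?y \<theta> \<eta> = \<phi> z" "x \<in> Obj C" "a \<in> Sec ?y x" for \<theta> z x a
    using that nat_trans_Sec[OF \<eta>n, of x a] nt_comp_apply[of x C a ?y \<theta> \<eta>] by simp
  have "nt_comp C ?y ?m \<eta> = nt_comp C ?y ?m' \<eta>"
  proof (rule nat_trans_ext)
    show "nt_comp C ?y ?m \<eta> \<in> nat_trans C ?y A" "nt_comp C ?y ?m' \<eta> \<in> nat_trans C ?y A"
      using nt_comp_nat_trans[OF category_axioms p(3) \<eta>n] mn by auto
    fix x a assume a: "x \<in> Obj C" "a \<in> Sec ?y x"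
    then have aA: "a \<in> Arr C" "Dom C a = x" "Cod C a = e" by (auto simp: Sec_yoneda hom_def)
    have "m x (Res B a b) = m x (Res B a b')"
      using nat_trans_natural[OF m aA(1), of b] nat_trans_natural[OF m aA(1), of b'] aA b by simp
    then show "nt_comp C ?y ?m \<eta> x a = nt_comp C ?y ?m' \<eta> x a"
      unfolding v[OF \<psi>(2) a] v[OF \<psi>'(2) a] using a by (simp add: \<phi>_def)
  qed
  \<comment> \<open>The uniqueness part of the universal property turns agreement after
    \<open>\<eta>\<close> into agreement of the composites with \<open>m\<close>, to which monicity
    applies.\<close>
  moreover have "\<exists>!\<psi>. \<psi> \<in> nat_trans C ?L A \<and> nt_comp C ?y \<psi> \<eta> = nt_comp C ?y ?m \<eta>"
    using \<eta> A nt_comp_nat_trans[OF category_axioms p(3) \<eta>n mn(1)] unfolding sheafification_def by blast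
  ultimately have "?m = ?m'" using mn by metis
  then have "(B, m, A) \<odot>\<^bsub>Sh C ?J\<^esub> (?L, \<psi>, B) = (B, m, A) \<odot>\<^bsub>Sh C ?J\<^esub> (?L, \<psi>', B)"
    by (simp add: Sh_def)
  moreover have "(?L, \<psi>, B) \<in> hom (Sh C ?J) ?L B" "(?L, \<psi>', B) \<in> hom (Sh C ?J) ?L B" "?L \<in> Obj (Sh C ?J)"
    "Dom (Sh C ?J) (B, m, A) = B"
    using L B \<psi> \<psi>' by (auto simp: hom_def Sh_def)
  ultimately have "(?L, \<psi>, B) = (?L, \<psi>', B)" using mm unfolding monic_def by metis
  then have "\<phi> b = \<phi> b'" using \<psi> \<psi>' by simp
  then have "\<phi> b e (Ident C e) = \<phi> b' e (Ident C e)" by simp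
  then show "b = b'" using e b p by (simp add: \<phi>_def Sec_yoneda Ident_hom Res_Ident)
qed

text \<open>A section of a non-zero subobject restricts to some \<open>Res A k x\<close>. Images of
  monomorphisms are closed under descent, so \<open>x\<close> itself lies in the image, and then so
  does every section, being locally a restriction of \<open>x\<close>. The injection
  \<open>i\<close> makes representables available as test objects for monomorphisms.\<close>

lemma locally_generated_atom:
  fixes A :: "('o, 'a, 'u) presheaf" and i :: "'a \<Rightarrow> 'u"
  assumes i: "inj i" and A: "is_sheaf C (atomic_topology C) A"
    and c: "c \<in> Obj C" and g: "locally_generated A c x"
  shows "atom (Sh C (atomic_topology C)) A"
proof -
  let ?J = "atomic_topology C"
  have p: "is_presheaf C A" using A by (rule is_sheaf_presheaf)
  have x: "x \<in> Sec A c" using g by (simp add: locally_generated_def)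
  have gen: "\<exists>h k. h \<in> Arr C \<and> k \<in> Arr C \<and> Dom C k = Dom C h \<and> Cod C k = c \<and> Cod C h = e \<and> Res A h y = Res A k x"
    if "e \<in> Obj C" "y \<in> Sec A e" for e y
    using g that unfolding locally_generated_def hom_def by blast
  have "initial_object (Sh C ?J) B \<or> isomorphism (Sh C ?J) (B, m, A)"
    if mm: "monic (Sh C ?J) (B, m, A)" for B m
  proof (cases "initial_object (Sh C ?J) B")
    case False
    have B: "is_sheaf C ?J B" and m: "m \<in> nat_trans C B A"
      using mm by (auto simp: monic_def Sh_def)
    have pB: "is_presheaf C B" using B by (rule is_sheaf_presheaf)
    note inj = monic_Sh_injective[OF i mm]
    note closed = mono_image_closed[OF B A m inj]
    have res: "Res A a y \<in> m (Dom C a) ` Sec B (Dom C a)"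
      if "a \<in> Arr C" "y \<in> m (Cod C a) ` Sec B (Cod C a)" for a y
    proof -
      obtain b where b: "b \<in> Sec B (Cod C a)" "y = m (Cod C a) b" using \<open>y \<in> m (Cod C a) ` Sec B (Cod C a)\<close> by blast
      then show ?thesis
        using nat_trans_natural[OF m \<open>a \<in> Arr C\<close> b(1)] Res_Sec[OF pB \<open>a \<in> Arr C\<close> b(1)]
        by (metis imageI)
    qed
    obtain e b where e: "e \<in> Obj C" "b \<in> Sec B e" using False initial_Sh_iff[OF B] by auto
    obtain h k where hk: "h \<in> Arr C" "k \<in> Arr C" "Dom C k = Dom C h" "Cod C k = c" "Cod C h = e"
      "Res A h (m e b) = Res A k x" using gen[of e "m e b"] e nat_trans_Sec[OF m] by blast
    have "Res A k x \<in> m (Dom C k) ` Sec B (Dom C k)" using res[of h "m e b"] hk e by auto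
    then have xm: "x \<in> m c ` Sec B c" using closed[of k x] hk x by simp
    have "y \<in> m e ` Sec B e" if y: "e \<in> Obj C" "y \<in> Sec A e" for e y
    proof -
      obtain h k where hk: "h \<in> Arr C" "k \<in> Arr C" "Dom C k = Dom C h" "Cod C k = c" "Cod C h = e"
        "Res A h y = Res A k x" using gen[OF y] by blast
      then show ?thesis using res[of k x] xm closed[of h y] y by auto
    qed
    then have "bij_betw (m e) (Sec B e) (Sec A e)" if "e \<in> Obj C" for e
      using that inj nat_trans_Sec[OF m] by (auto simp: bij_betw_def)
    then show ?thesis using isomorphism_Sh_iff[OF category_axioms B A m] m by (simp add: nat_bij_def)
  qed simp
  moreover have "\<not> initial_object (Sh C ?J) A" using initial_Sh_iff[OF A] x c by auto
  moreover have "A \<in> Obj (Sh C ?J)" using A by (simp add: Sh_def)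
  ultimately show ?thesis unfolding atom_def by (auto simp: Sh_def)
qed

text \<open>\<open>x\<close> and \<open>f\<close> present \<open>A\<close> and
  \<open>yoneda C d\<close> as locally surjective images of \<open>yoneda C c\<close> with the same
  kernel, and such images are isomorphic.\<close>

lemma locally_generated_representable:
  assumes A: "is_sheaf C (atomic_topology C) A" and c: "c \<in> Obj C" and lg: "locally_generated A c x"
    and f: "f \<in> hom C c d"
    and ker: "\<And>e a b. e \<in> Obj C \<Longrightarrow> a \<in> hom C e c \<Longrightarrow> b \<in> hom C e c \<Longrightarrow>
      f \<odot> a = f \<odot> b \<longleftrightarrow> Res A a x = Res A b x"
  shows "\<exists>\<tau>. nat_bij C A (yoneda C d) \<tau>"
proof -
  have p: "is_presheaf C A" using A by (rule is_sheaf_presheaf)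
  have x: "x \<in> Sec A c" using lg by (simp add: locally_generated_def)
  have fA: "f \<in> Arr C" "Dom C f = c" "Cod C f = d" using f by (auto simp: hom_def)
  have d: "d \<in> Obj C" using fA by auto
  have ker': "f \<odot> a = f \<odot> b \<longleftrightarrow> Res A a x = Res A b x"
    if "a \<in> Arr C" "b \<in> Arr C" "Dom C a = Dom C b" "Cod C a = c" "Cod C b = c" for a b
    using that ker[of "Dom C a" a b] by (simp add: hom_def)
  \<comment> \<open>\<open>y\<close> and \<open>t\<close> correspond when, along some common
    \<open>h\<close>, they become the images of one and the same arrow \<open>g\<close> under the
    two presentations.\<close>
  define T where "T e y t \<longleftrightarrow> y \<in> Sec A e \<and> t \<in> Arr C \<and> Dom C t = e \<and> Cod C t = d \<and>
    (\<exists>h g. h \<in> Arr C \<and> g \<in> Arr C \<and> Dom C g = Dom C h \<and> Cod C g = c \<and> Cod C h = e \<and>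
      Res A h y = Res A g x \<and> t \<odot> h = f \<odot> g)" for e y t
  have "\<exists>\<tau>. nat_bij C A (yoneda C d) \<tau> \<and> (\<forall>c\<in>Obj C. \<forall>y\<in>Sec A c. T c y (\<tau> c y))"
  proof (rule nat_bij_of_relation[OF category_axioms p])
    show "y \<in> Sec A e \<and> t \<in> Sec (yoneda C d) e" if "T e y t" for e y t
      using that by (auto simp: T_def Sec_yoneda hom_def)
  next
    fix e y assume e: "e \<in> Obj C" and y: "y \<in> Sec A e"
    then obtain h g where hg: "h \<in> Arr C" "g \<in> Arr C" "Dom C g = Dom C h" "Cod C g = c" "Cod C h = e"
      "Res A h y = Res A g x" using lg unfolding locally_generated_def hom_def by blast
    \<comment> \<open>Arrows equalised by \<open>h\<close> give equal restrictions of
      \<open>y\<close>, hence of \<open>x\<close> after composing with \<open>g\<close>; by the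
      kernel hypothesis \<open>f \<odot> g\<close> does not distinguish them either. Subcanonicity
      then glues it to \<open>t\<close>.\<close>
    have "descends (yoneda C d) h (f \<odot> g)"
      unfolding descends_def
    proof (intro ballI impI)
      fix u v assume uv: "u \<in> Arr C" "v \<in> Arr C" "Cod C u = Dom C h" "Cod C v = Dom C h" "h \<odot> u = h \<odot> v"
      have "Dom C u = Dom C v" using uv hg comp_simps(2) by metis
      moreover have "Res A (g \<odot> u) x = Res A (h \<odot> u) y"
        using uv(1-4) hg x y p by (simp add: Res_Comp)
      moreover have "Res A (g \<odot> v) x = Res A (h \<odot> v) y"
        using uv(1-4) hg x y p by (simp add: Res_Comp)
      ultimately have "f \<odot> (g \<odot> u) = f \<odot> (g \<odot> v)" using ker'[of "g \<odot> u" "g \<odot> v"] uv hg by simp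
      then show "Res (yoneda C d) u (f \<odot> g) = Res (yoneda C d) v (f \<odot> g)"
        using uv hg fA by (simp add: Res_yoneda)
    qed
    then obtain t where "t \<in> Sec (yoneda C d) (Cod C h)" "Res (yoneda C d) h t = f \<odot> g"
      using sheaf_descent[OF sheaf_yoneda[OF d] hg(1), of "f \<odot> g"] hg fA
      by (auto simp: Sec_yoneda hom_def)
    then have "T e y t" using hg y unfolding T_def Sec_yoneda Res_yoneda hom_def by blast
    then show "\<exists>t. T e y t" ..
  next
    fix e t assume e: "e \<in> Obj C" and "t \<in> Sec (yoneda C d) e"
    then have t: "t \<in> Arr C" "Dom C t = e" "Cod C t = d" by (auto simp: Sec_yoneda hom_def)
    \<comment> \<open>Dual amalgamation applied to \<open>t\<close> and \<open>f\<close> is the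
      local surjectivity of \<open>f\<close>.\<close>
    obtain h g where hg: "h \<in> Arr C" "g \<in> Arr C" "Cod C h = Dom C t" "Cod C g = Dom C f"
      "Dom C h = Dom C g" "t \<odot> h = f \<odot> g" using ore_square[of t f] t fA by metis
    have "descends A h (Res A g x)"
      unfolding descends_def
    proof (intro ballI impI)
      fix u v assume uv: "u \<in> Arr C" "v \<in> Arr C" "Cod C u = Dom C h" "Cod C v = Dom C h" "h \<odot> u = h \<odot> v"
      have D: "Dom C u = Dom C v" using uv hg comp_simps(2) by metis
      have "f \<odot> (g \<odot> w) = t \<odot> (h \<odot> w)" if "w \<in> Arr C" "Cod C w = Dom C h" for w
        using that hg fA t comp_assoc by metis
      then have "f \<odot> (g \<odot> u) = f \<odot> (g \<odot> v)" using uv by simp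
      then have "Res A (g \<odot> u) x = Res A (g \<odot> v) x" using ker' D uv hg fA by simp
      then show "Res A u (Res A g x) = Res A v (Res A g x)" using uv hg fA x p by (simp add: Res_Comp)
    qed
    then obtain y where "y \<in> Sec A e" "Res A h y = Res A g x"
      using sheaf_descent[OF A hg(1), of "Res A g x"] hg fA x p t Res_Sec[OF p hg(2)] by auto
    then have "T e y t" using hg t fA unfolding T_def by metis
    then show "\<exists>y. T e y t" ..
  next
    fix e y t y' t' assume "T e y t" "T e y' t'"
    then obtain h g h' g' where t: "t \<in> Arr C" "Dom C t = e" "Cod C t = d" "y \<in> Sec A e"
      and t': "t' \<in> Arr C" "Dom C t' = e" "Cod C t' = d" "y' \<in> Sec A e"
      and hg: "h \<in> Arr C" "g \<in> Arr C" "Dom C g = Dom C h" "Cod C g = c" "Cod C h = e"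
        "Res A h y = Res A g x" "t \<odot> h = f \<odot> g"
      and hg': "h' \<in> Arr C" "g' \<in> Arr C" "Dom C g' = Dom C h'" "Cod C g' = c" "Cod C h' = e"
        "Res A h' y' = Res A g' x" "t' \<odot> h' = f \<odot> g'"
      unfolding T_def by blast
    \<comment> \<open>On a common refinement both sections are restrictions of \<open>x\<close> and
      both arrows factor through \<open>f\<close>, so the kernel hypothesis compares them. The
      refinement is then cancelled by separatedness of \<open>A\<close> and by
      \<open>arrow_epic\<close>.\<close>
    obtain u v where uv: "u \<in> Arr C" "v \<in> Arr C" "Cod C u = Dom C h" "Cod C v = Dom C h'"
      "Dom C u = Dom C v" "h \<odot> u = h' \<odot> v" using ore_square[of h h'] hg hg' by metis
    let ?r = "h \<odot> u"
    have r: "?r \<in> Arr C" "Cod C ?r = e" "Dom C ?r = Dom C u" using uv(1-5) hg by auto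
    have "Res A ?r y = Res A (g \<odot> u) x" using uv(1-5) hg t x p by (simp add: Res_Comp)
    moreover have "Res A ?r y' = Res A (g' \<odot> v) x"
      unfolding uv(6) using uv(1-5) hg' t' x p by (simp add: Res_Comp)
    moreover have "t \<odot> ?r = f \<odot> (g \<odot> u)"
      using uv(1-5) hg t fA comp_assoc by metis
    moreover have "t' \<odot> ?r = f \<odot> (g' \<odot> v)"
      unfolding uv(6) using uv(1-5) hg' t' fA comp_assoc by metis
    moreover have "f \<odot> (g \<odot> u) = f \<odot> (g' \<odot> v) \<longleftrightarrow> Res A (g \<odot> u) x = Res A (g' \<odot> v) x"
      using ker' uv hg hg' by simp
    ultimately have "Res A ?r y = Res A ?r y' \<longleftrightarrow> t \<odot> ?r = t' \<odot> ?r" by simp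
    moreover have "Res A ?r y = Res A ?r y' \<longleftrightarrow> y = y'"
      using sheaf_separated[OF A r(1), of y y'] t t' r by auto
    moreover have "t \<odot> ?r = t' \<odot> ?r \<longleftrightarrow> t = t'"
      using arrow_epic[OF r(1) t(1) t'(1)] t t' r by auto
    ultimately show "y = y' \<longleftrightarrow> t = t'" by simp
  next
    fix a y t assume a: "a \<in> Arr C" and "T (Cod C a) y t"
    then obtain h g where t: "t \<in> Arr C" "Dom C t = Cod C a" "Cod C t = d" "y \<in> Sec A (Cod C a)"
      and hg: "h \<in> Arr C" "g \<in> Arr C" "Dom C g = Dom C h" "Cod C g = c" "Cod C h = Cod C a"
        "Res A h y = Res A g x" "t \<odot> h = f \<odot> g"
      unfolding T_def by blast
    obtain u v where uv: "u \<in> Arr C" "v \<in> Arr C" "Cod C u = Dom C h" "Cod C v = Dom C a"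
      "Dom C u = Dom C v" "h \<odot> u = a \<odot> v" using ore_square[of h a] hg a by metis
    have "Res A v (Res A a y) = Res A (h \<odot> u) y" using uv t a p by (simp add: Res_Comp)
    also have "\<dots> = Res A (g \<odot> u) x" using uv(1-5) hg t x p by (simp add: Res_Comp)
    finally have 1: "Res A v (Res A a y) = Res A (g \<odot> u) x" .
    have "(t \<odot> a) \<odot> v = t \<odot> (h \<odot> u)" using uv t a by simp
    also have "\<dots> = f \<odot> (g \<odot> u)" using uv(1-5) hg t fA comp_assoc by metis
    finally have 2: "(t \<odot> a) \<odot> v = f \<odot> (g \<odot> u)" .
    have "v \<in> Arr C \<and> g \<odot> u \<in> Arr C \<and> Dom C (g \<odot> u) = Dom C v \<and> Cod C (g \<odot> u) = c \<and>
      Cod C v = Dom C a" using uv hg by simp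
    then have "\<exists>h g. h \<in> Arr C \<and> g \<in> Arr C \<and> Dom C g = Dom C h \<and> Cod C g = c \<and> Cod C h = Dom C a \<and>
      Res A h (Res A a y) = Res A g x \<and> (t \<odot> a) \<odot> h = f \<odot> g" using 1 2 by blast
    then show "T (Dom C a) (Res A a y) (Res (yoneda C d) a t)"
      unfolding T_def Res_yoneda using t a Res_Sec[OF p a t(4)] by simp
  qed
  then show ?thesis by blast
qed

end

section \<open>Quotients of representables\<close>

lemma (in ore_category) sheaf_nat_bij:
  assumes F: "is_sheaf C (atomic_topology C) F" and pG: "is_presheaf C G" and \<tau>: "nat_bij C F G \<tau>"
  shows "is_sheaf C (atomic_topology C) G"
proof (rule sheafI_descent[OF pG])
  have pF: "is_presheaf C F" using F by (rule is_sheaf_presheaf)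
  obtain \<sigma> where \<sigma>: "nat_bij C G F \<sigma>" "\<And>c x. c \<in> Obj C \<Longrightarrow> x \<in> Sec F c \<Longrightarrow> \<sigma> c (\<tau> c x) = x"
    "\<And>c y. c \<in> Obj C \<Longrightarrow> y \<in> Sec G c \<Longrightarrow> \<tau> c (\<sigma> c y) = y"
    using nat_bij_inverse[OF category_axioms pF pG \<tau>] by blast
  have t: "\<tau> \<in> nat_trans C F G" and s: "\<sigma> \<in> nat_trans C G F"
    using \<tau> \<sigma>(1) by (auto simp: nat_bij_def)
  fix h y assume h: "h \<in> Arr C" and y: "y \<in> Sec G (Dom C h)" and d: "descends G h y"
  let ?c = "Cod C h" and ?e = "Dom C h"
  have c: "?c \<in> Obj C" "?e \<in> Obj C" using h by auto
  have "descends F h (\<sigma> ?e y)"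
    unfolding descends_def
  proof (intro ballI impI)
    fix u v assume uv: "u \<in> Arr C" "v \<in> Arr C" "Cod C u = ?e" "Cod C v = ?e" "h \<odot> u = h \<odot> v"
    then have "Dom C u = Dom C v" "Res G u y = Res G v y"
      using d h comp_simps(2) unfolding descends_def by metis+
    then show "Res F u (\<sigma> ?e y) = Res F v (\<sigma> ?e y)"
      using nat_trans_natural[OF s uv(1)] nat_trans_natural[OF s uv(2)] uv y by metis
  qed
  moreover have "\<sigma> ?e y \<in> Sec F ?e" using nat_trans_Sec[OF s c(2) y] .
  ultimately have "\<exists>!x. x \<in> Sec F ?c \<and> Res F h x = \<sigma> ?e y" using sheaf_descent[OF F h] by blast
  then obtain x where x: "x \<in> Sec F ?c" "Res F h x = \<sigma> ?e y"
    and u: "\<And>x'. x' \<in> Sec F ?c \<Longrightarrow> Res F h x' = \<sigma> ?e y \<Longrightarrow> x' = x" by blast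
  show "\<exists>!z. z \<in> Sec G ?c \<and> Res G h z = y"
  proof (rule ex1I[of _ "\<tau> ?c x"])
    have "Res G h (\<tau> ?c x) = y" using nat_trans_natural[OF t h x(1)] x(2) \<sigma>(3)[OF c(2) y] by simp
    then show "\<tau> ?c x \<in> Sec G ?c \<and> Res G h (\<tau> ?c x) = y" using nat_trans_Sec[OF t c(1) x(1)] by simp
  next
    fix z assume z: "z \<in> Sec G ?c \<and> Res G h z = y"
    then have "Res F h (\<sigma> ?c z) = \<sigma> ?e y" using nat_trans_natural[OF s h, of z] by simp
    then have "\<sigma> ?c z = x" using u nat_trans_Sec[OF s c(1)] z by blast
    then show "z = \<tau> ?c x" using \<sigma>(3)[OF c(1)] z by metis
  qed
qed

text \<open>Moves a sheaf to another element type, as is needed to bring the quotient sheaf into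
  \<open>'u\<close>. Injectivity is asked only on the sections over each single object, since the
  code of a germ there need not determine it among all sets of pairs; hence the inverse is taken
  relative to \<open>Sec F (Cod C a)\<close>.\<close>

lemma (in ore_category) relabel_sheaf:
  fixes F :: "('o, 'a, 'x) presheaf" and j :: "'x \<Rightarrow> 'y"
  assumes F: "is_sheaf C (atomic_topology C) F"
    and j: "\<And>e. e \<in> Obj C \<Longrightarrow> inj_on j (Sec F e)"
  shows "\<exists>(G :: ('o, 'a, 'y) presheaf) \<tau>. is_sheaf C (atomic_topology C) G \<and> nat_bij C F G \<tau>"
proof -
  define G where "G = \<lparr>Sec = (\<lambda>e. j ` Sec F e),
    Res = (\<lambda>a y. j (Res F a (inv_into (Sec F (Cod C a)) j y)))\<rparr>"
  have pF: "is_presheaf C F" using F by (rule is_sheaf_presheaf)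
  have S: "Sec G e = j ` Sec F e" for e by (simp add: G_def)
  have R: "Res G a (j x) = j (Res F a x)" if "a \<in> Arr C" "x \<in> Sec F (Cod C a)" for a x
    using that j[of "Cod C a"] by (simp add: G_def)
  have pG: "is_presheaf C G"
    unfolding is_presheaf_def S using pF by (auto simp: R Res_Sec Res_Ident Res_Comp)
  define \<tau> where "\<tau> = (\<lambda>e\<in>Obj C. \<lambda>x\<in>Sec F e. j x)"
  have "\<tau> \<in> nat_trans C F G"
    unfolding \<tau>_def by (rule nat_transI[OF category_axioms pF]) (auto simp: S R)
  moreover have "bij_betw (\<tau> e) (Sec F e) (Sec G e)" if "e \<in> Obj C" for e
    using that j[OF that] by (auto simp: \<tau>_def S bij_betw_def inj_on_def)
  ultimately have "nat_bij C F G \<tau>" by (simp add: nat_bij_def)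
  then show ?thesis using sheaf_nat_bij[OF F pG] by blast
qed

lemma (in ore_category) locally_generated_nat_bij:
  assumes lg: "locally_generated F c x" and c: "c \<in> Obj C" and \<tau>: "nat_bij C F G \<tau>"
  shows "locally_generated G c (\<tau> c x)"
proof -
  have t: "\<tau> \<in> nat_trans C F G" and x: "x \<in> Sec F c"
    using \<tau> lg by (auto simp: nat_bij_def locally_generated_def)
  have "\<exists>h\<in>Arr C. \<exists>g\<in>hom C (Dom C h) c. Cod C h = e \<and> Res G h z = Res G g (\<tau> c x)"
    if e: "e \<in> Obj C" and z: "z \<in> Sec G e" for e z
  proof -
    obtain y where y: "y \<in> Sec F e" "z = \<tau> e y"
      using \<tau> e z by (auto simp: nat_bij_def bij_betw_def)
    then obtain h g where hg: "h \<in> Arr C" "g \<in> hom C (Dom C h) c" "Cod C h = e" "Res F h y = Res F g x"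
      using lg e unfolding locally_generated_def by blast
    have "Res G h z = \<tau> (Dom C h) (Res F h y)"
      using nat_trans_natural[OF t hg(1), of y] y hg(3) by simp
    also have "\<dots> = Res G g (\<tau> c x)"
      unfolding hg(4) using nat_trans_natural[OF t, of g x] hg(2) x by (auto simp: hom_def)
    finally show ?thesis using hg by blast
  qed
  then show ?thesis using nat_trans_Sec[OF t c x] by (simp add: locally_generated_def)
qed

text \<open>A closed equivalence relation on \<open>yoneda C c\<close>, flattened to one set because
  a pair of parallel arrows determines its domain. \<open>E_local\<close> is closedness for the
  atomic topology, in which every single arrow generates a cover.\<close>

locale local_congruence = ore_category C for C :: "('o, 'a) cat" (structure) +
  fixes c :: 'o and E :: "('a \<times> 'a) set"
  assumes c: "c \<in> Obj C"
    and E_Arr: "(a, b) \<in> E \<Longrightarrow> a \<in> Arr C \<and> b \<in> Arr C \<and> Dom C a = Dom C b \<and> Cod C a = c \<and> Cod C b = c"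
    and E_refl: "a \<in> Arr C \<Longrightarrow> Cod C a = c \<Longrightarrow> (a, a) \<in> E"
    and E_sym: "(a, b) \<in> E \<Longrightarrow> (b, a) \<in> E"
    and E_trans: "(a, b) \<in> E \<Longrightarrow> (b, b') \<in> E \<Longrightarrow> (a, b') \<in> E"
    and E_comp: "(a, b) \<in> E \<Longrightarrow> u \<in> Arr C \<Longrightarrow> Cod C u = Dom C a \<Longrightarrow> (a \<odot> u, b \<odot> u) \<in> E"
    and E_local: "a \<in> Arr C \<Longrightarrow> b \<in> Arr C \<Longrightarrow> Dom C a = Dom C b \<Longrightarrow> Cod C a = c \<Longrightarrow> Cod C b = c \<Longrightarrow>
      u \<in> Arr C \<Longrightarrow> Cod C u = Dom C a \<Longrightarrow> (a \<odot> u, b \<odot> u) \<in> E \<Longrightarrow> (a, b) \<in> E"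
begin

definition span :: "'o \<Rightarrow> 'a \<Rightarrow> 'a \<Rightarrow> bool" where
  "span e h g \<longleftrightarrow> h \<in> Arr C \<and> g \<in> Arr C \<and> Dom C g = Dom C h \<and> Cod C h = e \<and> Cod C g = c"

text \<open>A section over \<open>e\<close> of the sheaf associated with \<open>yoneda C c\<close> modulo \<open>E\<close> is encoded as the
  set of all \<open>(h, g)\<close> such that its restriction along \<open>h\<close> is the class of \<open>g\<close>.
  With this encoding restriction is strictly functorial.\<close>

definition germ :: "'o \<Rightarrow> ('a \<times> 'a) set \<Rightarrow> bool" where
  "germ e K \<longleftrightarrow> K \<noteq> {} \<and> (\<forall>h g. (h, g) \<in> K \<longrightarrow> span e h g) \<and>
    (\<forall>h g u. (h, g) \<in> K \<longrightarrow> u \<in> Arr C \<longrightarrow> Cod C u = Dom C h \<longrightarrow> (h \<odot> u, g \<odot> u) \<in> K) \<and>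
    (\<forall>h g u. span e h g \<longrightarrow> u \<in> Arr C \<longrightarrow> Cod C u = Dom C h \<longrightarrow> (h \<odot> u, g \<odot> u) \<in> K \<longrightarrow> (h, g) \<in> K) \<and>
    (\<forall>h g g'. (h, g) \<in> K \<longrightarrow> (h, g') \<in> K \<longrightarrow> (g, g') \<in> E) \<and>
    (\<forall>h g g'. (h, g) \<in> K \<longrightarrow> (g, g') \<in> E \<longrightarrow> (h, g') \<in> K)"

definition germ_res :: "'a \<Rightarrow> ('a \<times> 'a) set \<Rightarrow> ('a \<times> 'a) set" where
  "germ_res a K = {(h, g). h \<in> Arr C \<and> Cod C h = Dom C a \<and> (a \<odot> h, g) \<in> K}"

definition quotient_sheaf :: "('o, 'a, ('a \<times> 'a) set) presheaf" where
  "quotient_sheaf = \<lparr>Sec = (\<lambda>e. {K. germ e K}), Res = germ_res\<rparr>"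

lemma germD:
  assumes "germ e K"
  shows "K \<noteq> {}" "(h, g) \<in> K \<Longrightarrow> span e h g"
    "(h, g) \<in> K \<Longrightarrow> u \<in> Arr C \<Longrightarrow> Cod C u = Dom C h \<Longrightarrow> (h \<odot> u, g \<odot> u) \<in> K"
    "span e h g \<Longrightarrow> u \<in> Arr C \<Longrightarrow> Cod C u = Dom C h \<Longrightarrow> (h \<odot> u, g \<odot> u) \<in> K \<Longrightarrow> (h, g) \<in> K"
    "(h, g) \<in> K \<Longrightarrow> (h, g') \<in> K \<Longrightarrow> (g, g') \<in> E"
    "(h, g) \<in> K \<Longrightarrow> (g, g') \<in> E \<Longrightarrow> (h, g') \<in> K"
  using assms unfolding germ_def by blast+

text \<open>An Ore square brings the shared member and an arbitrary member of \<open>K\<close> over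
  the same arrow. There their second components are \<open>E\<close>-related, so \<open>L\<close>,
  being saturated under \<open>E\<close> and local, contains the arbitrary member too. Descent, the
  kernel and local generation then need only one common member.\<close>

lemma germ_subset:
  assumes K: "germ e K" and L: "germ e L" and hK: "(h, g) \<in> K" and hL: "(h, g) \<in> L"
  shows "K \<subseteq> L"
proof clarify
  fix h' g' assume h': "(h', g') \<in> K"
  have s: "span e h g" "span e h' g'" using germD(2)[OF K] hK h' by auto
  then obtain u v where uv: "u \<in> Arr C" "v \<in> Arr C" "Cod C u = Dom C h" "Cod C v = Dom C h'"
    "Dom C u = Dom C v" "h \<odot> u = h' \<odot> v" using ore_square[of h h'] unfolding span_def by metis
  have "(h' \<odot> v, g \<odot> u) \<in> K" "(h' \<odot> v, g' \<odot> v) \<in> K" "(h' \<odot> v, g \<odot> u) \<in> L"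
    using germD(3)[OF K hK uv(1,3)] germD(3)[OF K h' uv(2,4)] germD(3)[OF L hL uv(1,3)] uv(6) by simp_all
  then have "(h' \<odot> v, g' \<odot> v) \<in> L" using germD(5)[OF K] germD(6)[OF L] by blast
  then show "(h', g') \<in> L" using germD(4)[OF L s(2) uv(2,4)] by simp
qed

lemma germ_eqI: "germ e K \<Longrightarrow> germ e L \<Longrightarrow> (h, g) \<in> K \<Longrightarrow> (h, g) \<in> L \<Longrightarrow> K = L"
  using germ_subset by blast

text \<open>The class of the identity of \<open>c\<close> restricts along \<open>h\<close> to the
  class of \<open>h\<close>, so its code consists of the pairs \<open>(h, g)\<close> with
  \<open>h\<close> and \<open>g\<close> related, which is \<open>E\<close> itself. It is the section
  that gives the quotient map.\<close>

lemma germ_E: "germ c E"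
  unfolding germ_def
proof (intro conjI allI impI)
  show "E \<noteq> {}" using E_refl[of "Ident C c"] c by auto
  fix h g assume hg: "(h, g) \<in> E"
  show "span c h g" using E_Arr[OF hg] by (simp add: span_def)
  show "(h \<odot> u, g \<odot> u) \<in> E" if "u \<in> Arr C" "Cod C u = Dom C h" for u using E_comp[OF hg that] .
  show "(g, g') \<in> E" if "(h, g') \<in> E" for g' using E_trans[OF E_sym[OF hg] that] .
  show "(h, g') \<in> E" if "(g, g') \<in> E" for g' using E_trans[OF hg that] .
next
  fix h g u assume "span c h g" "u \<in> Arr C" "Cod C u = Dom C h" "(h \<odot> u, g \<odot> u) \<in> E"
  then show "(h, g) \<in> E" using E_local[of h g u] by (simp add: span_def)
qed

lemma germ_germ_res:
  assumes a: "a \<in> Arr C" and K: "germ (Cod C a) K"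
  shows "germ (Dom C a) (germ_res a K)"
  unfolding germ_def
proof (intro conjI allI impI)
  \<comment> \<open>Non-emptiness is where an Ore square is needed: a member of \<open>K\<close>
    over \<open>h\<close> must be moved to an arrow factoring through \<open>a\<close>.\<close>
  obtain h g where h: "(h, g) \<in> K" using germD(1)[OF K] by auto
  then have s: "span (Cod C a) h g" using germD(2)[OF K] by blast
  then obtain u v where uv: "u \<in> Arr C" "v \<in> Arr C" "Cod C u = Dom C h" "Cod C v = Dom C a"
    "Dom C u = Dom C v" "h \<odot> u = a \<odot> v" using ore_square[of h a] a unfolding span_def by metis
  have "(a \<odot> v, g \<odot> u) \<in> K" using germD(3)[OF K h uv(1,3)] uv(6) by simp
  then show "germ_res a K \<noteq> {}" using uv unfolding germ_res_def by blast
next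
  fix h g assume "(h, g) \<in> germ_res a K"
  then show "span (Dom C a) h g" using germD(2)[OF K, of "a \<odot> h" g] a by (auto simp: span_def germ_res_def)
next
  fix h g u assume "(h, g) \<in> germ_res a K" "u \<in> Arr C" "Cod C u = Dom C h"
  then show "(h \<odot> u, g \<odot> u) \<in> germ_res a K"
    using germD(3)[OF K, of "a \<odot> h" g u] a by (auto simp: germ_res_def)
next
  fix h g u assume "span (Dom C a) h g" "u \<in> Arr C" "Cod C u = Dom C h" "(h \<odot> u, g \<odot> u) \<in> germ_res a K"
  then show "(h, g) \<in> germ_res a K"
    using germD(4)[OF K, of "a \<odot> h" g u] a by (auto simp: germ_res_def span_def)
next
  fix h g g' assume h: "(h, g) \<in> germ_res a K"
  then have K1: "(a \<odot> h, g) \<in> K" by (simp add: germ_res_def)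
  show "(g, g') \<in> E" if "(h, g') \<in> germ_res a K"
    using germD(5)[OF K K1] that by (simp add: germ_res_def)
  show "(h, g') \<in> germ_res a K" if "(g, g') \<in> E"
    using germD(6)[OF K K1 that] h by (simp add: germ_res_def)
qed

lemma presheaf_quotient: "is_presheaf C quotient_sheaf"
  unfolding is_presheaf_def quotient_sheaf_def
proof (simp only: presheaf.simps mem_Collect_eq, intro conjI ballI allI impI)
  show "germ (Dom C a) (germ_res a K)" if "a \<in> Arr C" "K \<in> {K. germ (Cod C a) K}" for a K
    using that germ_germ_res by simp
next
  fix e K assume e: "e \<in> Obj C" and "K \<in> {K. germ e K}"
  then have s: "span e h g" if "(h, g) \<in> K" for h g using germD(2) that by blast
  show "germ_res (Ident C e) K = K"
  proof (intro set_eqI, clarify)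
    fix h g
    show "(h, g) \<in> germ_res (Ident C e) K \<longleftrightarrow> (h, g) \<in> K"
      using s[of h g] e by (auto simp: germ_res_def span_def)
  qed
next
  fix a b K assume ab: "a \<in> Arr C" "b \<in> Arr C" "Cod C b = Dom C a"
  then show "germ_res (a \<odot> b) K = germ_res b (germ_res a K)" by (auto simp: germ_res_def)
qed

text \<open>Locality of \<open>E\<close> makes \<open>yoneda C c\<close> modulo \<open>E\<close>
  separated, so one completion step suffices: a germ is a matching family of classes on the largest
  sieve where it has such values, and these already glue.\<close>

lemma sheaf_quotient: "is_sheaf C (atomic_topology C) quotient_sheaf"
proof (rule sheafI_descent[OF presheaf_quotient])
  fix a K assume a: "a \<in> Arr C" and "K \<in> Sec quotient_sheaf (Dom C a)"
    and desc: "descends quotient_sheaf a K"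
  then have K: "germ (Dom C a) K" by (simp add: quotient_sheaf_def)
  have dc: "germ_res u K = germ_res v K"
    if "u \<in> Arr C" "v \<in> Arr C" "Cod C u = Dom C a" "Cod C v = Dom C a" "a \<odot> u = a \<odot> v" for u v
    using desc that unfolding descends_def quotient_sheaf_def presheaf.simps by blast
  \<comment> \<open>The glued section takes the value \<open>g\<close> along \<open>h\<close> if,
    after some \<open>p\<close> through which \<open>h\<close> factors over \<open>a\<close> as
    \<open>h \<odot> p = a \<odot> k\<close>, the given \<open>K\<close> takes the value
    \<open>g \<odot> p\<close> along \<open>k\<close>.\<close>
  define L where "L = {(h, g). span (Cod C a) h g \<and> (\<exists>p k. p \<in> Arr C \<and> k \<in> Arr C \<and>
    Cod C p = Dom C h \<and> Cod C k = Dom C a \<and> Dom C p = Dom C k \<and> h \<odot> p = a \<odot> k \<and> (k, g \<odot> p) \<in> K)}"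
  have LK: "(a \<odot> k, g) \<in> L" if k: "(k, g) \<in> K" for k g
  proof -
    have s: "span (Dom C a) k g" using germD(2)[OF K k] .
    then have "span (Cod C a) (a \<odot> k) g" using a by (simp add: span_def)
    moreover have "Ident C (Dom C k) \<in> Arr C \<and> k \<in> Arr C \<and> Cod C (Ident C (Dom C k)) = Dom C (a \<odot> k) \<and>
      Cod C k = Dom C a \<and> Dom C (Ident C (Dom C k)) = Dom C k \<and> (a \<odot> k) \<odot> Ident C (Dom C k) = a \<odot> k \<and>
      (k, g \<odot> Ident C (Dom C k)) \<in> K"
      using s a k by (simp add: span_def)
    ultimately show ?thesis unfolding L_def by blast
  qed
  have L: "germ (Cod C a) L"
    unfolding germ_def
  proof (intro conjI allI impI)
    show "L \<noteq> {}" using LK germD(1)[OF K] by auto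
    show "span (Cod C a) h g" if "(h, g) \<in> L" for h g using that by (simp add: L_def)
  next
    fix h g r assume "(h, g) \<in> L" and r: "r \<in> Arr C" "Cod C r = Dom C h"
    then obtain p k where s: "span (Cod C a) h g" and p: "p \<in> Arr C" "k \<in> Arr C"
      "Cod C p = Dom C h" "Cod C k = Dom C a" "Dom C p = Dom C k" "h \<odot> p = a \<odot> k" "(k, g \<odot> p) \<in> K"
      unfolding L_def by blast
    obtain u v where uv: "u \<in> Arr C" "v \<in> Arr C" "Cod C u = Dom C p" "Cod C v = Dom C r"
      "Dom C u = Dom C v" "p \<odot> u = r \<odot> v" using ore_square[of p r] p r by metis
    have "(h \<odot> r) \<odot> v = h \<odot> (p \<odot> u)" unfolding uv(6) using s r uv(1-5) by (simp add: span_def)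
    also have "\<dots> = (h \<odot> p) \<odot> u" using s p(1-5) uv(1-5) by (simp add: span_def)
    also have "\<dots> = a \<odot> (k \<odot> u)" unfolding p(6) using p(1-5) uv(1-5) a by simp
    finally have 1: "(h \<odot> r) \<odot> v = a \<odot> (k \<odot> u)" .
    have "(g \<odot> p) \<odot> u = g \<odot> (p \<odot> u)" using s p(1-5) uv(1-5) by (simp add: span_def)
    also have "\<dots> = (g \<odot> r) \<odot> v" unfolding uv(6) using s r uv(1-5) by (simp add: span_def)
    finally have 2: "(k \<odot> u, (g \<odot> r) \<odot> v) \<in> K" using germD(3)[OF K p(7) uv(1)] uv(3) p(5) by simp
    have "span (Cod C a) (h \<odot> r) (g \<odot> r)" using s r by (simp add: span_def)
    moreover have "v \<in> Arr C \<and> k \<odot> u \<in> Arr C \<and> Cod C v = Dom C (h \<odot> r) \<and> Cod C (k \<odot> u) = Dom C a \<and>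
      Dom C v = Dom C (k \<odot> u)" using s r uv(1-5) p(1-5) by (simp add: span_def)
    ultimately show "(h \<odot> r, g \<odot> r) \<in> L" using 1 2 unfolding L_def by blast
  next
    fix h g r assume s: "span (Cod C a) h g" and r: "r \<in> Arr C" "Cod C r = Dom C h" and "(h \<odot> r, g \<odot> r) \<in> L"
    then obtain p k where p: "p \<in> Arr C" "k \<in> Arr C" "Cod C p = Dom C r" "Cod C k = Dom C a"
      "Dom C p = Dom C k" "h \<odot> (r \<odot> p) = a \<odot> k" "(k, g \<odot> (r \<odot> p)) \<in> K"
      by (auto simp: L_def span_def)
    moreover have "r \<odot> p \<in> Arr C \<and> Cod C (r \<odot> p) = Dom C h \<and> Dom C (r \<odot> p) = Dom C k"
      using r p(1-5) by simp
    ultimately show "(h, g) \<in> L" using s unfolding L_def by blast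
  next
    fix h g g' assume "(h, g) \<in> L" "(h, g') \<in> L"
    then obtain p k p' k' where s: "span (Cod C a) h g" "span (Cod C a) h g'"
      and p: "p \<in> Arr C" "k \<in> Arr C" "Cod C p = Dom C h" "Cod C k = Dom C a" "Dom C p = Dom C k"
        "h \<odot> p = a \<odot> k" "(k, g \<odot> p) \<in> K"
      and p': "p' \<in> Arr C" "k' \<in> Arr C" "Cod C p' = Dom C h" "Cod C k' = Dom C a" "Dom C p' = Dom C k'"
        "h \<odot> p' = a \<odot> k'" "(k', g' \<odot> p') \<in> K"
      unfolding L_def by blast
    obtain u v where uv: "u \<in> Arr C" "v \<in> Arr C" "Cod C u = Dom C p" "Cod C v = Dom C p'"
      "Dom C u = Dom C v" "p \<odot> u = p' \<odot> v" using ore_square[of p p'] p p' by metis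
    have h: "h \<in> Arr C" "g \<in> Arr C" "g' \<in> Arr C" "Dom C g = Dom C h" "Dom C g' = Dom C h"
      "Cod C g = c" "Cod C g' = c" using s by (auto simp: span_def)
    have "a \<odot> (k \<odot> u) = (h \<odot> p) \<odot> u" unfolding p(6) using p(1-5) uv(1-5) a by simp
    also have "\<dots> = h \<odot> (p \<odot> u)" using h p(1-5) uv(1-5) by simp
    also have "\<dots> = (h \<odot> p') \<odot> v" unfolding uv(6) using h p'(1-5) uv(1-5) by simp
    also have "\<dots> = a \<odot> (k' \<odot> v)" unfolding p'(6) using p'(1-5) uv(1-5) a by simp
    \<comment> \<open>Here the descent condition enters: \<open>k \<odot> u\<close> and
      \<open>k' \<odot> v\<close> agree after \<open>a\<close>. Reading the equal restrictions at
      the identity \<open>?i\<close> transfers a value of \<open>K\<close> from the first arrow to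
      the second, where both values can be compared.\<close>
    finally have eq: "germ_res (k \<odot> u) K = germ_res (k' \<odot> v) K"
      using dc[of "k \<odot> u" "k' \<odot> v"] p(1-5) p'(1-5) uv(1-5) by simp
    let ?i = "Ident C (Dom C u)"
    have "(k \<odot> u, g \<odot> (p \<odot> u)) \<in> K"
      using germD(3)[OF K p(7) uv(1)] uv(3) p(1-5) h uv(1) by simp
    then have "(?i, g \<odot> (p \<odot> u)) \<in> germ_res (k \<odot> u) K"
      using p(1-5) uv(1-5) by (simp add: germ_res_def)
    then have 1: "(k' \<odot> v, g \<odot> (p \<odot> u)) \<in> K"
      unfolding eq using p'(1-5) uv(1-5) by (simp add: germ_res_def)
    have "(k' \<odot> v, g' \<odot> (p \<odot> u)) \<in> K"
      unfolding uv(6) using germD(3)[OF K p'(7) uv(2)] uv(4) p'(1-5) h uv(2) by simp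
    then have "(g \<odot> (p \<odot> u), g' \<odot> (p \<odot> u)) \<in> E" using germD(5)[OF K 1] by blast
    then show "(g, g') \<in> E" using E_local[of g g' "p \<odot> u"] h p(1-5) uv(1-3) by simp
  next
    fix h g g' assume "(h, g) \<in> L" and g: "(g, g') \<in> E"
    then obtain p k where s: "span (Cod C a) h g" and p: "p \<in> Arr C" "k \<in> Arr C"
      "Cod C p = Dom C h" "Cod C k = Dom C a" "Dom C p = Dom C k" "h \<odot> p = a \<odot> k" "(k, g \<odot> p) \<in> K"
      unfolding L_def by blast
    have "(g \<odot> p, g' \<odot> p) \<in> E" using E_comp[OF g p(1)] p(3) s by (simp add: span_def)
    then have "(k, g' \<odot> p) \<in> K" using germD(6)[OF K p(7)] by blast
    moreover have "span (Cod C a) h g'" using s E_Arr[OF g] by (auto simp: span_def)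
    ultimately show "(h, g') \<in> L" using p(1-6) unfolding L_def by blast
  qed
  have "L' = L" if L': "germ (Cod C a) L'" "germ_res a L' = K" for L'
  proof -
    obtain k g where "(k, g) \<in> K" using germD(1)[OF K] by auto
    then show ?thesis using germ_eqI[OF L'(1) L] LK L'(2) by (auto simp: germ_res_def)
  qed
  moreover have "germ_res a L = K"
  proof -
    obtain k g where k: "(k, g) \<in> K" using germD(1)[OF K] by auto
    then have "(k, g) \<in> germ_res a L"
      using LK germD(2)[OF K k] by (auto simp: germ_res_def span_def)
    then show ?thesis using germ_eqI[OF germ_germ_res[OF a L] K] k by blast
  qed
  ultimately show "\<exists>!L. L \<in> Sec quotient_sheaf (Cod C a) \<and> Res quotient_sheaf a L = K"
    using L by (auto simp: quotient_sheaf_def)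
qed

text \<open>The members of \<open>germ_res a E\<close> over the identity of \<open>e\<close> are the
  pairs with second component related to \<open>a\<close>, so the restrictions can be tested
  there.\<close>

lemma Res_quotient_iff:
  assumes "a \<in> hom C e c" "b \<in> hom C e c"
  shows "Res quotient_sheaf a E = Res quotient_sheaf b E \<longleftrightarrow> (a, b) \<in> E"
proof -
  have ab: "a \<in> Arr C" "b \<in> Arr C" "Dom C a = e" "Dom C b = e" "Cod C a = c" "Cod C b = c" "e \<in> Obj C"
    using assms by (auto simp: hom_def)
  let ?i = "Ident C e"
  have "germ_res a E = germ_res b E \<longleftrightarrow> (a, b) \<in> E"
  proof
    assume e: "germ_res a E = germ_res b E"
    have "(?i, a) \<in> germ_res a E" using ab E_refl by (simp add: germ_res_def)
    then show "(a, b) \<in> E" unfolding e using ab E_sym by (simp add: germ_res_def)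
  next
    assume "(a, b) \<in> E"
    then have "(?i, b) \<in> germ_res a E" "(?i, b) \<in> germ_res b E"
      using ab E_refl by (simp_all add: germ_res_def)
    then show "germ_res a E = germ_res b E"
      using germ_eqI[of e "germ_res a E" "germ_res b E"] germ_germ_res[of a E] germ_germ_res[of b E] germ_E ab
      by simp
  qed
  then show ?thesis by (simp add: quotient_sheaf_def)
qed

text \<open>A member \<open>(h, g)\<close> of a germ is itself the witness: the restriction of the
  germ along \<open>h\<close> and that of \<open>E\<close> along \<open>g\<close> share the identity
  paired with \<open>g\<close>.\<close>

lemma quotient_locally_generated: "locally_generated quotient_sheaf c E"
proof -
  have "\<exists>h\<in>Arr C. \<exists>g\<in>hom C (Dom C h) c. Cod C h = e \<and> germ_res h K = germ_res g E"
    if K: "germ e K" for e K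
  proof -
    obtain h g where k: "(h, g) \<in> K" using germD(1)[OF K] by auto
    then have s: "h \<in> Arr C" "g \<in> Arr C" "Dom C g = Dom C h" "Cod C h = e" "Cod C g = c"
      using germD(2)[OF K k] by (auto simp: span_def)
    have "(Ident C (Dom C h), g) \<in> germ_res h K" "(Ident C (Dom C h), g) \<in> germ_res g E"
      using s k E_refl by (simp_all add: germ_res_def)
    then have "germ_res h K = germ_res g E"
      using germ_eqI[of "Dom C h" "germ_res h K" "germ_res g E"] germ_germ_res[of h K] germ_germ_res[of g E]
        germ_E K s by simp
    then show ?thesis using s by (auto simp: hom_def)
  qed
  then show ?thesis using germ_E by (simp add: locally_generated_def quotient_sheaf_def)
qed

text \<open>A germ is determined by any one of its members, so it can be coded by a pair of arrows.\<close>

lemma inj_on_germ: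
  assumes "inj i"
  shows "inj_on (\<lambda>K. i (SOME k. k \<in> K)) (Sec quotient_sheaf e)"
proof (rule inj_onI)
  fix K L assume "K \<in> Sec quotient_sheaf e" "L \<in> Sec quotient_sheaf e"
    and e: "i (SOME k. k \<in> K) = i (SOME k. k \<in> L)"
  then have K: "germ e K" and L: "germ e L" by (auto simp: quotient_sheaf_def)
  have m: "(SOME k. k \<in> K) \<in> K" "(SOME k. k \<in> L) \<in> L" using germD(1)[OF K] germD(1)[OF L] by (auto simp: some_in_eq)
  have "(SOME k. k \<in> K) = (SOME k. k \<in> L)" using assms e by (rule injD)
  then show "K = L" using m germ_eqI[OF K L] by (metis surj_pair)
qed

end

text \<open>This closure is the relation that the theorem compares with the kernel of
  \<open>f\<close>. Ore squares refine two witnesses to a common one for transitivity and pull a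
  witness back for composition; locality holds by composing witnesses.\<close>

lemma (in ore_category) local_congruence_closure:
  assumes c: "c \<in> Obj C" and R: "presheaf_equiv_rel C (yoneda C c) R"
  shows "local_congruence C c {(a, b). a \<in> Arr C \<and> b \<in> Arr C \<and> Dom C a = Dom C b \<and> Cod C a = c \<and> Cod C b = c \<and>
    (\<exists>h\<in>Arr C. Cod C h = Dom C a \<and> (a \<odot> h, b \<odot> h) \<in> R (Dom C h))}"
    (is "local_congruence C c ?E")
proof -
  have eq: "equiv (hom C e c) (R e)" if "e \<in> Obj C" for e
    using R that by (simp add: presheaf_equiv_rel_def Sec_yoneda)
  have Rr: "(a, a) \<in> R (Dom C a)" if "a \<in> Arr C" "Cod C a = c" for a
    using eq[of "Dom C a"] that by (auto simp: equiv_def refl_on_def hom_def)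
  have Rs: "(b, a) \<in> R e" if "(a, b) \<in> R e" "e \<in> Obj C" for a b e
    using eq[OF that(2)] that(1) by (meson equivE symD)
  have Rt: "(a, d) \<in> R e" if "(a, b) \<in> R e" "(b, d) \<in> R e" "e \<in> Obj C" for a b d e
    using eq[OF that(3)] that(1,2) by (meson equivE transD)
  have Rc: "(a \<odot> u, b \<odot> u) \<in> R (Dom C u)" if "(a, b) \<in> R (Cod C u)" "u \<in> Arr C" for a b u
    using R that unfolding presheaf_equiv_rel_def subfunctor_def presheaf_prod_def
    by (fastforce simp: Res_yoneda)
  have Rc2: "(a \<odot> (h \<odot> u), b \<odot> (h \<odot> u)) \<in> R (Dom C u)"
    if "(a \<odot> h, b \<odot> h) \<in> R (Dom C h)" "u \<in> Arr C" "Cod C u = Dom C h" "h \<in> Arr C" "a \<in> Arr C" "b \<in> Arr C"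
      "Cod C h = Dom C a" "Dom C a = Dom C b" for a b h u
    using Rc[of "a \<odot> h" "b \<odot> h" u] that by simp
  show ?thesis
  proof unfold_locales
    show "c \<in> Obj C" by fact
    show "(a, a) \<in> ?E" if "a \<in> Arr C" "Cod C a = c" for a
      using that Rr[OF that] by (auto intro!: bexI[of _ "Ident C (Dom C a)"])
    show "(b, a) \<in> ?E" if "(a, b) \<in> ?E" for a b using that Rs by auto
  next
    fix a b d assume ab: "(a, b) \<in> ?E" and bd: "(b, d) \<in> ?E"
    then obtain h k where A: "a \<in> Arr C" "b \<in> Arr C" "d \<in> Arr C" "Dom C a = Dom C b" "Dom C d = Dom C b"
      "Cod C a = c" "Cod C b = c" "Cod C d = c"
      and hk: "h \<in> Arr C" "k \<in> Arr C" "Cod C h = Dom C b" "Cod C k = Dom C b"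
      "(a \<odot> h, b \<odot> h) \<in> R (Dom C h)" "(b \<odot> k, d \<odot> k) \<in> R (Dom C k)"
      unfolding mem_Collect_eq prod.case by metis
    obtain u v where uv: "u \<in> Arr C" "v \<in> Arr C" "Cod C u = Dom C h" "Cod C v = Dom C k"
      "Dom C u = Dom C v" "h \<odot> u = k \<odot> v" using ore_square[of h k] hk by metis
    have "(a \<odot> (h \<odot> u), b \<odot> (h \<odot> u)) \<in> R (Dom C u)" using Rc2[OF hk(5) uv(1,3) hk(1)] A hk(3) by simp
    moreover have "(b \<odot> (h \<odot> u), d \<odot> (h \<odot> u)) \<in> R (Dom C u)"
      unfolding uv(5,6) by (rule Rc2[OF hk(6) uv(2,4) hk(2) A(2,3) hk(4) A(5)[symmetric]])
    ultimately have "(a \<odot> (h \<odot> u), d \<odot> (h \<odot> u)) \<in> R (Dom C u)" using Rt uv(1) by simp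
    moreover have "h \<odot> u \<in> Arr C" "Cod C (h \<odot> u) = Dom C a" "Dom C (h \<odot> u) = Dom C u"
      using hk uv(1-5) A by simp_all
    ultimately have "\<exists>w\<in>Arr C. Cod C w = Dom C a \<and> (a \<odot> w, d \<odot> w) \<in> R (Dom C w)" by metis
    then show "(a, d) \<in> ?E" using A by auto
  next
    fix a b u assume "(a, b) \<in> ?E" and u: "u \<in> Arr C" "Cod C u = Dom C a"
    then obtain h where A: "a \<in> Arr C" "b \<in> Arr C" "Dom C a = Dom C b" "Cod C a = c" "Cod C b = c"
      and h: "h \<in> Arr C" "Cod C h = Dom C a" "(a \<odot> h, b \<odot> h) \<in> R (Dom C h)" by auto
    obtain p q where pq: "p \<in> Arr C" "q \<in> Arr C" "Cod C p = Dom C h" "Cod C q = Dom C u"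
      "Dom C p = Dom C q" "h \<odot> p = u \<odot> q" using ore_square[of h u] h u by metis
    have "(a \<odot> (u \<odot> q), b \<odot> (u \<odot> q)) \<in> R (Dom C q)"
      using Rc2[OF h(3) pq(1,3)] A h unfolding pq(5,6) by simp
    then have "((a \<odot> u) \<odot> q, (b \<odot> u) \<odot> q) \<in> R (Dom C q)" using A u pq(2,4) by simp
    then show "(a \<odot> u, b \<odot> u) \<in> ?E" using A u pq(2,4) by auto
  next
    fix a b u assume A: "a \<in> Arr C" "b \<in> Arr C" "Dom C a = Dom C b" "Cod C a = c" "Cod C b = c"
      and u: "u \<in> Arr C" "Cod C u = Dom C a" and "(a \<odot> u, b \<odot> u) \<in> ?E"
    then obtain h where h: "h \<in> Arr C" "Cod C h = Dom C u" "((a \<odot> u) \<odot> h, (b \<odot> u) \<odot> h) \<in> R (Dom C h)" by auto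
    have "(a \<odot> (u \<odot> h), b \<odot> (u \<odot> h)) \<in> R (Dom C (u \<odot> h))" using h A u by simp
    then show "(a, b) \<in> ?E" using h A u by (auto intro!: bexI[of _ "u \<odot> h"])
  qed auto
qed

theorem proposition3p17:
  fixes C :: "('o, 'a) cat"
  assumes "category C"
    and "dual_amalgamation C"
    and "subcanonical C (atomic_topology C)"
    and "\<exists>i :: 'a \<times> 'a \<Rightarrow> 'u. inj i"
  shows "(\<forall>A :: ('o, 'a, 'u) presheaf. atom (Sh C (atomic_topology C)) A \<longrightarrow>
            (\<exists>c\<in>Obj C. isomorphic (Sh C (atomic_topology C)) A (l_obj C (atomic_topology C) c)))
    \<longleftrightarrow>
    (\<forall>c\<in>Obj C. \<forall>R. presheaf_equiv_rel C (yoneda C c) R \<longrightarrow>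
      (\<exists>d\<in>Obj C. \<exists>f\<in>hom C c d.
        \<forall>e\<in>Obj C. \<forall>a\<in>hom C e c. \<forall>b\<in>hom C e c.
          f \<odot>\<^bsub>C\<^esub> a = f \<odot>\<^bsub>C\<^esub> b \<longleftrightarrow>
          (\<exists>h\<in>Arr C. Cod C h = e \<and> (a \<odot>\<^bsub>C\<^esub> h, b \<odot>\<^bsub>C\<^esub> h) \<in> R (Dom C h))))"
    (is "?atoms \<longleftrightarrow> ?quotients")
proof -
  interpret atomic_site C
    using assms(1-3)
    by (simp add: atomic_site_def atomic_site_axioms_def ore_category_def ore_category_axioms_def)
  let ?J = "atomic_topology C"
  obtain i2 :: "'a \<times> 'a \<Rightarrow> 'u" where i2: "inj i2" using assms(4) by blast
  \<comment> \<open>The injection \<open>i2\<close> of pairs codes germs; its restriction to the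
    diagonal codes arrows, as \<open>l_obj\<close> requires.\<close>
  define i :: "'a \<Rightarrow> 'u" where "i a = i2 (a, a)" for a
  have i: "inj i" using i2 by (auto simp: i_def inj_def)
  note l = l_obj_nat_bij[OF assms(1,3) _ i]
  show ?thesis
  proof
    assume atoms: ?atoms
    show ?quotients
    proof (intro ballI allI impI)
      fix c R assume c: "c \<in> Obj C" and R: "presheaf_equiv_rel C (yoneda C c) R"
      define E where "E = {(a, b). a \<in> Arr C \<and> b \<in> Arr C \<and> Dom C a = Dom C b \<and> Cod C a = c \<and> Cod C b = c \<and>
        (\<exists>h\<in>Arr C. Cod C h = Dom C a \<and> (a \<odot>\<^bsub>C\<^esub> h, b \<odot>\<^bsub>C\<^esub> h) \<in> R (Dom C h))}"
      interpret local_congruence C c E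
        unfolding E_def by (rule local_congruence_closure[OF c R])
      let ?Q = quotient_sheaf
      obtain G :: "('o, 'a, 'u) presheaf" and \<tau> where G: "is_sheaf C ?J G" and \<tau>: "nat_bij C ?Q G \<tau>"
        \<comment> \<open>A germ is coded by a chosen member, which is a pair of arrows and so fits
          into \<open>'u\<close>.\<close>
        using relabel_sheaf[OF sheaf_quotient inj_on_germ[OF i2]] by blast
      have pG: "is_presheaf C G" using G by (rule is_sheaf_presheaf)
      have "atom (Sh C ?J) G"
        by (rule locally_generated_atom[OF i G c locally_generated_nat_bij[OF quotient_locally_generated c \<tau>]])
      then obtain d where d: "d \<in> Obj C" and "isomorphic (Sh C ?J) G (l_obj C ?J d)" using atoms by blast
      then obtain \<alpha> where \<alpha>: "nat_bij C G (l_obj C ?J d :: ('o, 'a, 'u) presheaf) \<alpha>"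
        using isomorphic_Sh_iff[OF assms(1) G l(1)[OF d]] by blast
      have py: "is_presheaf C (yoneda C d)" using sheaf_yoneda[OF d] by (rule is_sheaf_presheaf)
      obtain \<beta> where "nat_bij C (l_obj C ?J d :: ('o, 'a, 'u) presheaf) (yoneda C d) \<beta>"
        using l(2)[OF d] nat_bij_inverse[OF assms(1) py is_sheaf_presheaf[OF l(1)[OF d]]] by blast
      then obtain \<phi> where \<phi>: "nat_bij C ?Q (yoneda C d) \<phi>"
        using nat_bij_comp[OF assms(1) presheaf_quotient \<tau> nat_bij_comp[OF assms(1) pG \<alpha>]] by blast
      then have n: "\<phi> \<in> nat_trans C ?Q (yoneda C d)" by (simp add: nat_bij_def)
      have E: "E \<in> Sec ?Q c" using quotient_locally_generated by (simp add: locally_generated_def)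
      \<comment> \<open>The required arrow: the image of the generating section \<open>E\<close>. By
        naturality, composing it with \<open>a\<close> is applying \<open>\<phi>\<close> to
        \<open>Res ?Q a E\<close>, so by injectivity of \<open>\<phi>\<close> its kernel is that of
        \<open>E\<close>.\<close>
      have f: "\<phi> c E \<in> hom C c d" using nat_trans_Sec[OF n c E] by (simp add: Sec_yoneda)
      have "\<phi> c E \<odot>\<^bsub>C\<^esub> a = \<phi> c E \<odot>\<^bsub>C\<^esub> b \<longleftrightarrow>
          (\<exists>h\<in>Arr C. Cod C h = e \<and> (a \<odot>\<^bsub>C\<^esub> h, b \<odot>\<^bsub>C\<^esub> h) \<in> R (Dom C h))"
        if e: "e \<in> Obj C" and a: "a \<in> hom C e c" and b: "b \<in> hom C e c" for e a b
      proof -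
        have v: "\<phi> c E \<odot>\<^bsub>C\<^esub> x = \<phi> e (Res ?Q x E)" "Res ?Q x E \<in> Sec ?Q e" if "x \<in> hom C e c" for x
          using nat_trans_natural[OF n, of x E] Res_Sec[OF presheaf_quotient, of x E] that E
          by (auto simp: hom_def Res_yoneda)
        have "\<phi> c E \<odot>\<^bsub>C\<^esub> a = \<phi> c E \<odot>\<^bsub>C\<^esub> b \<longleftrightarrow> Res ?Q a E = Res ?Q b E"
          using \<phi> v[OF a] v[OF b] e by (auto simp: nat_bij_def bij_betw_def dest: inj_onD)
        also have "\<dots> \<longleftrightarrow> (a, b) \<in> E" by (rule Res_quotient_iff[OF a b])
        finally show ?thesis using a b by (auto simp: E_def hom_def)
      qed
      then show "\<exists>d\<in>Obj C. \<exists>f\<in>hom C c d. \<forall>e\<in>Obj C. \<forall>a\<in>hom C e c. \<forall>b\<in>hom C e c.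
          f \<odot>\<^bsub>C\<^esub> a = f \<odot>\<^bsub>C\<^esub> b \<longleftrightarrow>
          (\<exists>h\<in>Arr C. Cod C h = e \<and> (a \<odot>\<^bsub>C\<^esub> h, b \<odot>\<^bsub>C\<^esub> h) \<in> R (Dom C h))"
        using d f by blast
    qed
  next
    assume quot: ?quotients
    show ?atoms
    proof (intro allI impI)
      fix A :: "('o, 'a, 'u) presheaf" assume at: "atom (Sh C ?J) A"
      then have A: "is_sheaf C ?J A" by (simp add: atom_def Sh_def)
      have pA: "is_presheaf C A" using A by (rule is_sheaf_presheaf)
      obtain c x where c: "c \<in> Obj C" and lg: "locally_generated A c x"
        using atom_locally_generated[OF at] by blast
      then have x: "x \<in> Sec A c" by (simp add: locally_generated_def)
      \<comment> \<open>The kernel of the map from \<open>yoneda C c\<close> to \<open>A\<close>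
        given by \<open>x\<close>.\<close>
      define R where "R e = {(a, b). a \<in> hom C e c \<and> b \<in> hom C e c \<and> Res A a x = Res A b x}" for e
      have "subfunctor C R (presheaf_prod (yoneda C c) (yoneda C c))"
        using pA x by (auto simp: subfunctor_def presheaf_prod_def yoneda_def R_def hom_def Res_Comp)
      moreover have "equiv (hom C e c) (R e)" for e
        by (rule equivI) (auto simp: R_def refl_on_def sym_def trans_def)
      ultimately have "presheaf_equiv_rel C (yoneda C c) R"
        by (simp add: presheaf_equiv_rel_def Sec_yoneda)
      then obtain d f where d: "d \<in> Obj C" and f: "f \<in> hom C c d"
        and fR: "\<And>e a b. e \<in> Obj C \<Longrightarrow> a \<in> hom C e c \<Longrightarrow> b \<in> hom C e c \<Longrightarrow>
          f \<odot>\<^bsub>C\<^esub> a = f \<odot>\<^bsub>C\<^esub> b \<longleftrightarrow> (\<exists>h\<in>Arr C. Cod C h = e \<and> (a \<odot>\<^bsub>C\<^esub> h, b \<odot>\<^bsub>C\<^esub> h) \<in> R (Dom C h))"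
        using quot c by metis
      \<comment> \<open>Separatedness of \<open>A\<close> makes \<open>R\<close> local already, so
        the existential over \<open>h\<close> adds no pairs; conversely the identity of
        \<open>e\<close> serves as \<open>h\<close>.\<close>
      have "f \<odot>\<^bsub>C\<^esub> a = f \<odot>\<^bsub>C\<^esub> b \<longleftrightarrow> Res A a x = Res A b x"
        if e: "e \<in> Obj C" and a: "a \<in> hom C e c" and b: "b \<in> hom C e c" for e a b
      proof -
        have ab: "a \<in> Arr C" "b \<in> Arr C" "Dom C a = e" "Dom C b = e" "Cod C a = c" "Cod C b = c"
          using a b by (auto simp: hom_def)
        have "(a \<odot>\<^bsub>C\<^esub> h, b \<odot>\<^bsub>C\<^esub> h) \<in> R (Dom C h) \<longleftrightarrow> Res A a x = Res A b x"
          if h: "h \<in> Arr C" "Cod C h = e" for h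
        proof -
          have "(a \<odot>\<^bsub>C\<^esub> h, b \<odot>\<^bsub>C\<^esub> h) \<in> R (Dom C h) \<longleftrightarrow> Res A h (Res A a x) = Res A h (Res A b x)"
            using ab h x pA by (simp add: R_def hom_def Res_Comp)
          then show ?thesis
            using sheaf_separated[OF A h(1)] Res_Sec[OF pA ab(1)] Res_Sec[OF pA ab(2)] ab x h by auto
        qed
        then show ?thesis unfolding fR[OF e a b] using Ident_simps[OF e] by blast
      qed
      then obtain \<tau> where \<tau>: "nat_bij C A (yoneda C d) \<tau>"
        using locally_generated_representable[OF A c lg f] by blast
      obtain \<eta> where "nat_bij C (yoneda C d) (l_obj C ?J d :: ('o, 'a, 'u) presheaf) \<eta>"
        using l(2)[OF d] by blast
      then have "isomorphic (Sh C ?J) A (l_obj C ?J d)"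
        using isomorphic_Sh_iff[OF assms(1) A l(1)[OF d]] nat_bij_comp[OF assms(1) pA \<tau>] by blast
      then show "\<exists>c\<in>Obj C. isomorphic (Sh C ?J) A (l_obj C ?J c)" using d by blast
    qed
  qed
qed

end
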